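(* Let $X$ be a locally compact topological space, $\mu$ a $\sigma$-finite Borel measure on $X$, $L^p=L^p(X,\mu)$ (complex), and let $-\Lambda$ be the generator of a contraction $C_0$ semigroup $e^{-t\Lambda}$, $t\ge0$, in $L^2$. Assume that for some constants $M\ge1$, $c_S>0$, $j>1$, $c$: (B11) $\|e^{-t\Lambda}f\|_1\le M\|f\|_1$ for all $t\ge0$, $f\in L^1\cap L^2$; (B12) $\mathrm{Re}\langle\Lambda u,u\rangle\ge c_S\|u\|_{2j}^2$ for all $u\in D(\Lambda)$; (B13) $\|e^{-t\Lambda}\|_{2\to\infty}\le c\,t^{-j'/2}$ for all $t>0$, where $j'=\frac{j}{j-1}$. Assume further there is a family of real-valued weights $\{\psi_s\}_{s>0}$ on $X$ such that for all $s>0$: (B21) $0\le\psi_s$ and $\psi_s,\psi_s^{-1}\in L^1_{\mathrm{loc}}(X\setminus N,\mu)$, where $N$ is a closed $\mu$-null set; and there exist constants $\theta\in]0,1[$ and $c_2,c_3$, all independent of $s$, and for each $s$ a measurable set $\Omega^s\subset X$, such that (B22) $\psi_s(x)^{-\theta}\le c_2$ for all $x\in X\setminus\Omega^s$; (B23) $\|\psi_s^{-\theta}\|_{L^{q'}(\Omega^s)}\le c_3 s^{j'/q'}$, where $q'=\frac{2}{1-\theta}$. Finally assume (B3): there is a constant $c_1$ independent of $s$ such that for all $s>0$ and all $\frac s2\le t\le s$, $\|\psi_s e^{-t\Lambda}\psi_s^{-1}f\|_1\le c_1\|f\|_1$ for $f\in L^1$. Then there is a constant $C$ such that the integral kernel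 $e^{-t\Lambda}(x,y)$ of $e^{-t\Lambda}$ satisfies, for all $t>0$ and $\mu$-a.e. $x,y\in X$, $$|e^{-t\Lambda}(x,y)|\le C\,t^{-j'}\psi_t(y).$$
   Context: $\langle u,v\rangle=\int_X u\bar v\,d\mu$ and $\|\cdot\|_{p\to q}$ denotes the operator norm $L^p\to L^q$. *)

theory Defs
  imports "HOL-Analysis.Analysis"
begin

definition Lnorm :: "'a measure \<Rightarrow> real \<Rightarrow> ('a \<Rightarrow> 'b::{real_normed_vector,second_countable_topology}) \<Rightarrow> ennreal" where
  "Lnorm M p f =
     (if f \<in> borel_measurable M \<and> integrable M (\<lambda>x. norm (f x) powr p)
      then ennreal ((\<integral>x. norm (f x) powr p \<partial>M) powr (1 / p)) else \<infinity>)"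

definition memLp :: "'a measure \<Rightarrow> real \<Rightarrow> ('a \<Rightarrow> 'b::{real_normed_vector,second_countable_topology}) \<Rightarrow> bool" where
  "memLp M p f \<longleftrightarrow> f \<in> borel_measurable M \<and> integrable M (\<lambda>x. norm (f x) powr p)"

definition Linf_norm :: "'a measure \<Rightarrow> ('a \<Rightarrow> 'b::real_normed_vector) \<Rightarrow> ennreal" where
  "Linf_norm M f = Inf {C. AE x in M. ennreal (norm (f x)) \<le> C}"

text \<open>A contraction C_0 semigroup on L^2(M) (complex), acting on representatives;
  all identities are understood \<mu>-a.e. (i.e. in L^2).\<close>
definition contraction_C0_semigroup :: "'a measure \<Rightarrow> (real \<Rightarrow> ('a \<Rightarrow> complex) \<Rightarrow> ('a \<Rightarrow> complex)) \<Rightarrow> bool" where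
  "contraction_C0_semigroup M T \<longleftrightarrow>
     (\<forall>t\<ge>0. \<forall>f g. memLp M 2 f \<and> memLp M 2 g \<and> (AE x in M. f x = g x) \<longrightarrow> (AE x in M. T t f x = T t g x))
   \<and> (\<forall>t\<ge>0. \<forall>f g. memLp M 2 f \<and> memLp M 2 g \<longrightarrow>
          (AE x in M. T t (\<lambda>y. f y + g y) x = T t f x + T t g x))
   \<and> (\<forall>t\<ge>0. \<forall>f a. memLp M 2 f \<longrightarrow> (AE x in M. T t (\<lambda>y. a * f y) x = a * T t f x))
   \<and> (\<forall>t\<ge>0. \<forall>f. memLp M 2 f \<longrightarrow> Lnorm M 2 (T t f) \<le> Lnorm M 2 f)
   \<and> (\<forall>f. memLp M 2 f \<longrightarrow> (AE x in M. T 0 f x = f x))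
   \<and> (\<forall>s\<ge>0. \<forall>t\<ge>0. \<forall>f. memLp M 2 f \<longrightarrow> (AE x in M. T (s + t) f x = T s (T t f) x))
   \<and> (\<forall>f. memLp M 2 f \<longrightarrow>
          ((\<lambda>t. enn2real (Lnorm M 2 (\<lambda>x. T t f x - f x))) \<longlongrightarrow> 0) (at_right 0))"

text \<open>The generator -\<Lambda> of T: \<open>neg_generator M T u w\<close> means u \<in> D(\<Lambda>) and -\<Lambda> u = w,
  i.e. (T t u - u)/t \<rightarrow> w in L^2 as t \<rightarrow> 0+.\<close>
definition neg_generator :: "'a measure \<Rightarrow> (real \<Rightarrow> ('a \<Rightarrow> complex) \<Rightarrow> ('a \<Rightarrow> complex)) \<Rightarrow> ('a \<Rightarrow> complex) \<Rightarrow> ('a \<Rightarrow> complex) \<Rightarrow> bool" where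
  "neg_generator M T u w \<longleftrightarrow> memLp M 2 u \<and> memLp M 2 w \<and>
     (\<forall>\<^sub>F t in at_right 0. Lnorm M 2 (\<lambda>x. (T t u x - u x) / complex_of_real t - w x) < \<infinity>) \<and>
     ((\<lambda>t. enn2real (Lnorm M 2 (\<lambda>x. (T t u x - u x) / complex_of_real t - w x))) \<longlongrightarrow> 0) (at_right 0)"

definition locally_integrable_on :: "'a::topological_space measure \<Rightarrow> 'a set \<Rightarrow> ('a \<Rightarrow> real) \<Rightarrow> bool" where
  "locally_integrable_on M U g \<longleftrightarrow> (\<forall>K. compact K \<and> K \<subseteq> U \<longrightarrow> set_integrable M K g)"

end

theory Submission
  imports Defs
begin

text \<open>
  Fix \<open>s > 0\<close> and let \<open>u\<^sub>t = e\<^bsup>-t\<Lambda>\<^esup> f\<close>. If \<open>\<parallel>w u\<^sub>t\<parallel>\<^sub>1 \<le> N\<close> on \<open>[s/2, s]\<close>, splitting \<open>X\<close> along \<open>w \<ge> l\<close> gives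
  \<open>\<parallel>u\<^sub>t\<parallel>\<^sub>2\<^sup>2 \<le> \<parallel>u\<^sub>t\<parallel>\<^sub>\<infinity> N / l + \<parallel>u\<^sub>t\<parallel>\<^sub>\<infinity>\<^sup>2 \<mu>(w < l)\<close>, and (B13) bounds \<open>\<parallel>u\<^sub>t\<parallel>\<^sub>\<infinity>\<close> by the \<open>L\<^sup>2\<close> norm at an
  earlier time. With \<open>l\<close> chosen as a power of the elapsed time, the supremum over \<open>t\<close> of a suitably weighted
  \<open>L\<^sup>2\<close> norm absorbs itself, and a last application of (B13) yields \<open>\<parallel>u\<^sub>s\<parallel>\<^sub>\<infinity> \<le> C s\<^bsup>-j'\<^esup> N\<close>.
  For \<open>w = 1\<close> and (B11) this is the bound \<open>L\<^sup>1 \<rightarrow> L\<^sup>\<infinity>\<close>, which suffices for \<open>y\<close> outside \<open>\<Omega>\<^sup>s\<close>, where \<open>\<psi>\<^sub>s\<close> is bounded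
  below; for \<open>w = \<psi>\<^sub>s\<close> and (B3), with \<open>\<mu>(\<psi>\<^sub>s < l)\<close> controlled by (B23) and Chebyshev, it handles \<open>y \<in> \<Omega>\<^sup>s\<close>.
  Together, \<open>\<parallel>e\<^bsup>-t\<Lambda>\<^esup> f\<parallel>\<^sub>\<infinity> \<le> \<integral>\<phi> \<bar>f\<bar> d\<mu>\<close> with \<open>\<phi> \<le> C t\<^bsup>-j'\<^esup> \<psi>\<^sub>t\<close>.
  Such an operator has a kernel dominated by \<open>\<phi>(y)\<close> even if \<open>\<mu>\<close> is not separable: \<open>A \<times> B \<mapsto> \<integral>\<^sub>A e\<^bsup>-t\<Lambda>\<^esup> 1\<^sub>B d\<mu>\<close>
  extends to a measure on the product, which has a density.
\<close>

section \<open>Kernels of operators dominated by a measure\<close>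

text \<open>Caratheodory's extension theorem is applied below to set functions known only on
  rectangles, and it asks for this structure.\<close>

lemma semiring_of_sets_rectangles:
  "semiring_of_sets (space P \<times> space Q) {A \<times> B |A B. A \<in> sets P \<and> B \<in> sets Q}"
proof
  show "{A \<times> B |A B. A \<in> sets P \<and> B \<in> sets Q} \<subseteq> Pow (space P \<times> space Q)"
    by (rule pair_measure_closed)
  show "{} \<in> {A \<times> B |A B. A \<in> sets P \<and> B \<in> sets Q}"
    by (auto intro!: exI[of _ "{}"])
next
  fix a b assume "a \<in> {A \<times> B |A B. A \<in> sets P \<and> B \<in> sets Q}" "b \<in> {A \<times> B |A B. A \<in> sets P \<and> B \<in> sets Q}"
  then obtain A B C D where a: "a = A \<times> B" "b = C \<times> D"
    and [measurable]: "A \<in> sets P" "B \<in> sets Q" "C \<in> sets P" "D \<in> sets Q"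
    by auto
  have "a \<inter> b = (A \<inter> C) \<times> (B \<inter> D)"
    using a by auto
  then show "a \<inter> b \<in> {A \<times> B |A B. A \<in> sets P \<and> B \<in> sets Q}"
    by (auto intro!: exI[of _ "A \<inter> C"] exI[of _ "B \<inter> D"])
  show "\<exists>E\<subseteq>{A \<times> B |A B. A \<in> sets P \<and> B \<in> sets Q}. finite E \<and> disjoint E \<and> a - b = \<Union>E"
  proof (intro exI[of _ "{(A - C) \<times> B, (A \<inter> C) \<times> (B - D)}"] conjI subsetI)
    fix z assume "z \<in> {(A - C) \<times> B, (A \<inter> C) \<times> (B - D)}"
    moreover have "A - C \<in> sets P" "A \<inter> C \<in> sets P" "B - D \<in> sets Q"
      by measurable
    ultimately show "z \<in> {A \<times> B |A B. A \<in> sets P \<and> B \<in> sets Q}"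
      using \<open>B \<in> sets Q\<close> by blast
  qed (auto simp: a disjoint_def)
qed

text \<open>Domination turns finite additivity into countable additivity: what finitely many pieces
  leave of \<open>B\<close> has an \<open>R\<close> value between 0 and its \<open>Q\<close>
  measure, which tends to 0. For \<open>x\<close> in \<open>A\<close> the relevant pieces are the
  \<open>Bs n\<close> with \<open>x \<in> As n\<close>; they partition \<open>B\<close> because the
  rectangles partition \<open>A \<times> B\<close>.\<close>

lemma dominated_AE_additive_sums:
  fixes R :: "'b set \<Rightarrow> 'a \<Rightarrow> real"
  assumes Q: "finite_measure Q"
    and add: "\<And>B C. B \<in> sets Q \<Longrightarrow> C \<in> sets Q \<Longrightarrow> B \<inter> C = {} \<Longrightarrow> AE x in P. R (B \<union> C) x = R B x + R C x"
    and bnd: "\<And>B. B \<in> sets Q \<Longrightarrow> AE x in P. 0 \<le> R B x \<and> R B x \<le> measure Q B"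
    and As: "\<And>n. As n \<in> sets P" "A \<in> sets P" and Bs: "\<And>n::nat. Bs n \<in> sets Q" "B \<in> sets Q"
    and disj: "disjoint_family (\<lambda>n. As n \<times> Bs n)"
    and un: "(\<Union>n. As n \<times> Bs n) = A \<times> B"
  shows "AE x in P. (\<lambda>n. indicator (As n) x * R (Bs n) x) sums (indicator A x * R B x)"
proof -
  interpret Q: finite_measure Q by fact
  have fin_add: "AE x in P. R (\<Union>i\<in>F. Bs i) x = (\<Sum>i\<in>F. R (Bs i) x)"
    if "finite F" "disjoint_family_on Bs F" for F
    using that
  proof (induction F)
    case empty
    show ?case using bnd[of "{}"] by auto
  next
    case (insert i F)
    have "AE x in P. R (\<Union>i\<in>F. Bs i) x = (\<Sum>i\<in>F. R (Bs i) x)"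
      using insert by (intro insert.IH) (auto simp: disjoint_family_on_def)
    moreover have "AE x in P. R (Bs i \<union> (\<Union>i\<in>F. Bs i)) x = R (Bs i) x + R (\<Union>i\<in>F. Bs i) x"
      using insert Bs by (intro add) (auto simp: disjoint_family_on_def)
    ultimately show ?case
      by eventually_elim (use insert in simp)
  qed
  define \<F> where "\<F> = {F. finite F \<and> disjoint_family_on Bs F \<and> (\<Union>i\<in>F. Bs i) \<subseteq> B}"
  have "AE x in P. 0 \<le> R B x - (\<Sum>i\<in>F. R (Bs i) x) \<and>
          R B x - (\<Sum>i\<in>F. R (Bs i) x) \<le> measure Q B - (\<Sum>i\<in>F. measure Q (Bs i))" if "F \<in> \<F>" for F
  proof -
    have F: "finite F" "disjoint_family_on Bs F" "(\<Union>i\<in>F. Bs i) \<subseteq> B"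
      using that by (auto simp: \<F>_def)
    define U where "U = (\<Union>i\<in>F. Bs i)"
    have U: "U \<in> sets Q" "U \<subseteq> B"
      using F Bs by (auto simp: U_def)
    have "measure Q U = (\<Sum>i\<in>F. measure Q (Bs i))"
      unfolding U_def using F Bs by (intro Q.finite_measure_finite_Union) auto
    then have m: "measure Q (B - U) = measure Q B - (\<Sum>i\<in>F. measure Q (Bs i))"
      using Q.finite_measure_Diff[OF Bs(2) U] by simp
    have "AE x in P. R (U \<union> (B - U)) x = R U x + R (B - U) x"
      using U Bs by (intro add) auto
    moreover have "U \<union> (B - U) = B"
      using U by auto
    moreover have "AE x in P. 0 \<le> R (B - U) x \<and> R (B - U) x \<le> measure Q (B - U)"
      using U Bs by (intro bnd) auto
    ultimately show ?thesis
      using fin_add[OF F(1,2)] unfolding m U_def[symmetric] by auto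
  qed
  \<comment> \<open>Only countably many finite families occur, so one null set serves for all \<open>x\<close>, although the family relevant at \<open>x\<close> depends on \<open>x\<close>.\<close>
  moreover have "countable \<F>"
    by (rule countable_subset[OF _ countable_Collect_finite]) (auto simp: \<F>_def)
  ultimately have 1: "AE x in P. \<forall>F\<in>\<F>. 0 \<le> R B x - (\<Sum>i\<in>F. R (Bs i) x) \<and>
          R B x - (\<Sum>i\<in>F. R (Bs i) x) \<le> measure Q B - (\<Sum>i\<in>F. measure Q (Bs i))"
    by (subst AE_ball_countable) auto
  have 2: "AE x in P. R {} x = 0"
    using bnd[of "{}"] by auto
  show ?thesis
    using 1 2
  proof eventually_elim
    case (elim x)
    show ?case
    proof (cases "x \<in> A")
      case False
      then have "Bs n = {}" if "x \<in> As n" for n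
        using un that by blast
      then have "indicator (As n) x * R (Bs n) x = 0" for n
        using elim(2) by (cases "x \<in> As n") auto
      moreover have "indicator A x * R B x = 0"
        using False by simp
      ultimately show ?thesis by (simp only: sums_zero)
    next
      case True
      \<comment> \<open>The section at \<open>x\<close> of the \<open>n\<close>-th rectangle. Empty
        sections keep all \<open>n\<close> as indices, so countable additivity of \<open>Q\<close>
        applies directly.\<close>
      define C where "C n = (if x \<in> As n then Bs n else {})" for n
      have "disjoint_family C"
        unfolding disjoint_family_on_def
      proof (intro ballI impI)
        fix m n :: nat assume "m \<in> UNIV" "n \<in> UNIV" "m \<noteq> n"
        then have "(As m \<times> Bs m) \<inter> (As n \<times> Bs n) = {}"
          using disj by (simp add: disjoint_family_on_def)
        then show "C m \<inter> C n = {}"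
          by (auto simp: C_def)
      qed
      moreover have "(\<Union>n. C n) = B"
      proof -
        have "y \<in> (\<Union>n. C n) \<longleftrightarrow> (x, y) \<in> (\<Union>n. As n \<times> Bs n)" for y
          by (auto simp: C_def)
        then show ?thesis
          unfolding un using True by blast
      qed
      moreover have "range C \<subseteq> sets Q"
        using Bs by (auto simp: C_def)
      ultimately have sC: "(\<lambda>n. measure Q (C n)) sums measure Q B"
        using Q.finite_measure_UNION[of C] by simp
      \<comment> \<open>Dropping the empty sections leaves index sets that belong to
        \<open>\<F>\<close>, for which the estimate holds at \<open>x\<close>.\<close>
      define F where "F N = {n\<in>{..<N}. x \<in> As n}" for N
      have FF: "F N \<in> \<F>" for N
      proof -
        have "disjoint_family_on Bs (F N)"
          unfolding disjoint_family_on_def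
        proof (intro ballI impI)
          fix m n assume mn: "m \<in> F N" "n \<in> F N" "m \<noteq> n"
          then have "(As m \<times> Bs m) \<inter> (As n \<times> Bs n) = {}"
            using disj by (simp add: disjoint_family_on_def)
          with mn show "Bs m \<inter> Bs n = {}"
            by (auto simp: F_def)
        qed
        moreover have "(\<Union>i\<in>F N. Bs i) \<subseteq> B"
          using un unfolding F_def by blast
        ultimately show ?thesis by (auto simp: \<F>_def F_def)
      qed
      have e1: "(\<Sum>n<N. measure Q (C n)) = (\<Sum>i\<in>F N. measure Q (Bs i))" for N
        by (rule sum.mono_neutral_cong_right) (auto simp: F_def C_def)
      have e2: "(\<Sum>n<N. indicator (As n) x * R (Bs n) x) = (\<Sum>i\<in>F N. R (Bs i) x)" for N
        by (rule sum.mono_neutral_cong_right) (auto simp: F_def)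
      have "(\<lambda>N. R B x - (\<Sum>n<N. indicator (As n) x * R (Bs n) x)) \<longlonglongrightarrow> 0"
      proof (rule tendsto_sandwich[where f="\<lambda>_. 0"])
        show "(\<lambda>N. measure Q B - (\<Sum>n<N. measure Q (C n))) \<longlonglongrightarrow> 0"
          using tendsto_diff[OF tendsto_const sC[unfolded sums_def], of "measure Q B"] by simp
        show "\<forall>\<^sub>F N in sequentially. 0 \<le> R B x - (\<Sum>n<N. indicator (As n) x * R (Bs n) x)"
          using elim(1) FF unfolding e2 by auto
        show "\<forall>\<^sub>F N in sequentially. R B x - (\<Sum>n<N. indicator (As n) x * R (Bs n) x)
            \<le> measure Q B - (\<Sum>n<N. measure Q (C n))"
          using elim(1) FF unfolding e1 e2 by auto
      qed simp
      from tendsto_diff[OF tendsto_const this, of "R B x"]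
      show ?thesis using True by (simp add: sums_def)
    qed
  qed
qed

text \<open>Each \<open>R B\<close> is additive only up to a null set depending on the sets
  involved, so \<open>R\<close> at a fixed \<open>x\<close> need not be a measure. Integration over
  \<open>A\<close> removes this ambiguity and leaves a genuine set function on rectangles, which
  Caratheodory's theorem extends.\<close>

lemma bimeasure_extension:
  fixes R :: "'b set \<Rightarrow> 'a \<Rightarrow> real"
  assumes Q: "finite_measure Q"
    and meas: "\<And>B. B \<in> sets Q \<Longrightarrow> R B \<in> borel_measurable P"
    and add: "\<And>B C. B \<in> sets Q \<Longrightarrow> C \<in> sets Q \<Longrightarrow> B \<inter> C = {} \<Longrightarrow> AE x in P. R (B \<union> C) x = R B x + R C x"
    and bnd: "\<And>B. B \<in> sets Q \<Longrightarrow> AE x in P. 0 \<le> R B x \<and> R B x \<le> measure Q B"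
  obtains N where "sets N = sets (P \<Otimes>\<^sub>M Q)"
    and "\<And>A B. A \<in> sets P \<Longrightarrow> B \<in> sets Q \<Longrightarrow>
           emeasure N (A \<times> B) = (\<integral>\<^sup>+x. ennreal (R B x) * indicator A x \<partial>P)"
proof -
  define \<mu> where "\<mu> A B = (\<integral>\<^sup>+x. ennreal (R B x) * indicator A x \<partial>P)" for A B
  define N where "N = extend_measure (space P \<times> space Q) {(A, B). A \<in> sets P \<and> B \<in> sets Q}
     (\<lambda>(A, B). A \<times> B) (\<lambda>(A, B). \<mu> A B)"
  have \<mu>_empty: "\<mu> A B = 0" if "A \<in> sets P" "B \<in> sets Q" "A \<times> B = {}" for A B
  proof (cases "A = {}")
    case True
    then show ?thesis by (simp add: \<mu>_def)
  next
    case False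
    then have "B = {}" using that by auto
    then have "AE x in P. R B x = 0" using bnd[of "{}"] by auto
    then have "\<mu> A B = (\<integral>\<^sup>+x. 0 \<partial>P)"
      unfolding \<mu>_def by (intro nn_integral_cong_AE) auto
    then show ?thesis by simp
  qed
  have sets: "sets N = sets (P \<Otimes>\<^sub>M Q)"
  proof -
    have "(\<lambda>(A, B). A \<times> B) ` {(A, B). A \<in> sets P \<and> B \<in> sets Q} = {a \<times> b |a b. a \<in> sets P \<and> b \<in> sets Q}"
      by auto
    moreover have "{a \<times> b |a b. a \<in> sets P \<and> b \<in> sets Q} \<subseteq> Pow (space P \<times> space Q)"
      by (rule pair_measure_closed)
    ultimately show ?thesis
      unfolding N_def sets_pair_measure by (subst sets_extend_measure) auto
  qed
  have "emeasure N (A \<times> B) = \<mu> A B" if "A \<in> sets P" "B \<in> sets Q" for A B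
  proof (rule extend_measure_caratheodory_pair[OF N_def])
    show "A \<in> sets P \<and> B \<in> sets Q" using that by simp
    show "semiring_of_sets (space P \<times> space Q) {a \<times> b |a b. a \<in> sets P \<and> b \<in> sets Q}"
      by (rule semiring_of_sets_rectangles)
  next
    fix As :: "nat \<Rightarrow> 'a set" and Bs :: "nat \<Rightarrow> 'b set" and A B
    assume AB: "\<And>n. As n \<in> sets P \<and> Bs n \<in> sets Q" "A \<in> sets P \<and> B \<in> sets Q"
      and d: "disjoint_family (\<lambda>n. As n \<times> Bs n)" "(\<Union>i. As i \<times> Bs i) = A \<times> B"
    have "AE x in P. (\<lambda>n. indicator (As n) x * R (Bs n) x) sums (indicator A x * R B x)"
      using AB by (intro dominated_AE_additive_sums[OF Q add bnd _ _ _ _ d]) auto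
    moreover have "AE x in P. \<forall>n. 0 \<le> R (Bs n) x"
      using bnd AB(1) by (subst AE_all_countable) fastforce
    ultimately have "AE x in P. (\<Sum>n. ennreal (R (Bs n) x) * indicator (As n) x) = ennreal (R B x) * indicator A x"
    proof eventually_elim
      case (elim x)
      have "ennreal (indicator S x * r) = ennreal r * indicator S x" for r and S :: "'a set"
        by (cases "x \<in> S") auto
      with suminf_ennreal_eq[OF _ elim(1)] elim(2) show ?case by simp
    qed
    then have "\<mu> A B = (\<integral>\<^sup>+x. (\<Sum>n. ennreal (R (Bs n) x) * indicator (As n) x) \<partial>P)"
      unfolding \<mu>_def by (intro nn_integral_cong_AE) auto
    also have "\<dots> = (\<Sum>n. \<mu> (As n) (Bs n))"
      unfolding \<mu>_def
    proof (intro nn_integral_suminf)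
      fix n
      have [measurable]: "As n \<in> sets P" "R (Bs n) \<in> borel_measurable P"
        using AB meas by auto
      show "(\<lambda>x. ennreal (R (Bs n) x) * indicator (As n) x) \<in> borel_measurable P"
        by measurable
    qed
    finally show "(\<Sum>n. \<mu> (As n) (Bs n)) = \<mu> A B" ..
  next
    \<comment> \<open>The value must depend on the rectangle and not on its sides: a nonempty
      rectangle determines its sides, and all empty ones have value 0.\<close>
    fix A B C D assume *: "A \<in> sets P \<and> B \<in> sets Q" "C \<in> sets P \<and> D \<in> sets Q" "A \<times> B = C \<times> D"
    show "\<mu> A B = \<mu> C D"
    proof (cases "A \<times> B = {}")
      case True
      then show ?thesis using * \<mu>_empty by metis
    next
      case False
      then have "A = C" "B = D" using *(3) by (auto simp: times_eq_iff)
      then show ?thesis by simp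
    qed
  qed (use \<mu>_empty in auto)
  then show ?thesis
    using sets that unfolding \<mu>_def by blast
qed

text \<open>Since \<open>S\<close> is signed, \<open>(measure Q B + S B x) / 2\<close> and
  \<open>(measure Q B - S B x) / 2\<close> are extended instead; both lie between 0 and
  \<open>measure Q B\<close>. If \<open>g\<close> is the density of the first extension, then
  \<open>k = 2 * g - 1\<close>. Radon-Nikodym is needed only on the product space; uniqueness of
  densities in \<open>x\<close> recovers each \<open>S B\<close>.\<close>

lemma dominated_AE_additive_kernel:
  fixes S :: "'b set \<Rightarrow> 'a \<Rightarrow> real"
  assumes P: "finite_measure P" and Q: "finite_measure Q"
    and meas [measurable]: "\<And>B. B \<in> sets Q \<Longrightarrow> S B \<in> borel_measurable P"
    and add: "\<And>B C. B \<in> sets Q \<Longrightarrow> C \<in> sets Q \<Longrightarrow> B \<inter> C = {} \<Longrightarrow> AE x in P. S (B \<union> C) x = S B x + S C x"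
    and bnd: "\<And>B. B \<in> sets Q \<Longrightarrow> AE x in P. \<bar>S B x\<bar> \<le> measure Q B"
  obtains k where "k \<in> borel_measurable (P \<Otimes>\<^sub>M Q)" "\<And>z. \<bar>k z\<bar> \<le> 1"
    "\<And>B. B \<in> sets Q \<Longrightarrow> AE x in P. S B x = (\<integral>y. k (x, y) * indicator B y \<partial>Q)"
proof -
  interpret P: finite_measure P by fact
  interpret Q: finite_measure Q by fact
  interpret PQ: finite_measure "P \<Otimes>\<^sub>M Q"
    by (rule finite_measure_pair_measure[OF Q P])
  have half: "\<exists>N. sets N = sets (P \<Otimes>\<^sub>M Q) \<and> (\<forall>A\<in>sets P. \<forall>B\<in>sets Q.
      emeasure N (A \<times> B) = (\<integral>\<^sup>+x. ennreal ((measure Q B + e * S B x) / 2) * indicator A x \<partial>P))"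
    if e: "\<bar>e\<bar> = 1" for e
  proof -
    obtain N where "sets N = sets (P \<Otimes>\<^sub>M Q)" "\<And>A B. A \<in> sets P \<Longrightarrow> B \<in> sets Q \<Longrightarrow>
      emeasure N (A \<times> B) = (\<integral>\<^sup>+x. ennreal ((measure Q B + e * S B x) / 2) * indicator A x \<partial>P)"
    proof (rule bimeasure_extension[OF Q, where R="\<lambda>B x. (measure Q B + e * S B x) / 2" and P=P])
      fix B C assume BC: "B \<in> sets Q" "C \<in> sets Q" "B \<inter> C = {}"
      have "measure Q (B \<union> C) = measure Q B + measure Q C"
        using BC by (intro Q.finite_measure_Union)
      then show "AE x in P. (measure Q (B \<union> C) + e * S (B \<union> C) x) / 2 =
          (measure Q B + e * S B x) / 2 + (measure Q C + e * S C x) / 2"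
        using add[OF BC] by (auto simp: algebra_simps add_divide_distrib)
    next
      fix B assume "B \<in> sets Q"
      from bnd[OF this] show "AE x in P. 0 \<le> (measure Q B + e * S B x) / 2 \<and> (measure Q B + e * S B x) / 2 \<le> measure Q B"
      proof eventually_elim
        case (elim x)
        have "\<bar>e * S B x\<bar> \<le> measure Q B"
          using elim e by (simp add: abs_mult)
        then show ?case by (auto simp: abs_le_iff)
      qed
    qed auto
    then show ?thesis by blast
  qed
  obtain N where sets_N [measurable_cong]: "sets N = sets (P \<Otimes>\<^sub>M Q)"
    and N: "\<And>A B. A \<in> sets P \<Longrightarrow> B \<in> sets Q \<Longrightarrow>
      emeasure N (A \<times> B) = (\<integral>\<^sup>+x. ennreal ((measure Q B + S B x) / 2) * indicator A x \<partial>P)"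
    using half[of 1] by auto
  obtain N' where sets_N': "sets N' = sets (P \<Otimes>\<^sub>M Q)"
    and N': "\<And>A B. A \<in> sets P \<Longrightarrow> B \<in> sets Q \<Longrightarrow>
      emeasure N' (A \<times> B) = (\<integral>\<^sup>+x. ennreal ((measure Q B - S B x) / 2) * indicator A x \<partial>P)"
    using half[of "-1"] by auto
  \<comment> \<open>The extensions of \<open>(Q \<plusminus> S) / 2\<close> add up to the product measure; this gives \<open>N \<le> P \<Otimes>\<^sub>M Q\<close> without a monotone class argument for \<open>N\<close> alone.\<close>
  have rect: "emeasure N (A \<times> B) + emeasure N' (A \<times> B) = emeasure (P \<Otimes>\<^sub>M Q) (A \<times> B)"
    if [measurable]: "A \<in> sets P" "B \<in> sets Q" for A B
  proof -
    have "emeasure N (A \<times> B) + emeasure N' (A \<times> B)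
        = (\<integral>\<^sup>+x. ennreal ((measure Q B + S B x) / 2) * indicator A x
            + ennreal ((measure Q B - S B x) / 2) * indicator A x \<partial>P)"
      unfolding N[OF that] N'[OF that] by (rule nn_integral_add[symmetric]) measurable
    also have "\<dots> = (\<integral>\<^sup>+x. ennreal (measure Q B) * indicator A x \<partial>P)"
    proof (rule nn_integral_cong_AE)
      show "AE x in P. ennreal ((measure Q B + S B x) / 2) * indicator A x
            + ennreal ((measure Q B - S B x) / 2) * indicator A x = ennreal (measure Q B) * indicator A x"
        using bnd[OF that(2)]
      proof eventually_elim
        case (elim x)
        then have "ennreal ((measure Q B + S B x) / 2) + ennreal ((measure Q B - S B x) / 2)
            = ennreal ((measure Q B + S B x) / 2 + (measure Q B - S B x) / 2)"
          by (intro ennreal_plus[symmetric]) (auto simp: abs_le_iff)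
        also have "(measure Q B + S B x) / 2 + (measure Q B - S B x) / 2 = measure Q B"
          by (simp add: field_simps)
        finally show ?case by (simp add: distrib_right[symmetric])
      qed
    qed
    also have "\<dots> = emeasure (P \<Otimes>\<^sub>M Q) (A \<times> B)"
      by (simp add: nn_integral_cmult Q.emeasure_pair_measure_Times Q.emeasure_eq_measure) (simp add: mult.commute)
    finally show ?thesis .
  qed
  have space_N: "space N = space P \<times> space Q" "space N' = space P \<times> space Q"
    using sets_eq_imp_space_eq[OF sets_N] sets_eq_imp_space_eq[OF sets_N'] by (auto simp: space_pair_measure)
  have fin: "emeasure N (space P \<times> space Q) \<noteq> \<infinity>" "emeasure N' (space P \<times> space Q) \<noteq> \<infinity>"
    using rect[of "space P" "space Q", symmetric] PQ.emeasure_finite[of "space P \<times> space Q"] by auto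
  have fN: "finite_measure N" and fN': "finite_measure N'"
    using fin by (auto intro!: finite_measureI simp: space_N)
  \<comment> \<open>A pi-lambda argument starting from rectangles. The complement step subtracts,
    which is where finiteness of all three measures enters.\<close>
  have sum: "emeasure N Z + emeasure N' Z = emeasure (P \<Otimes>\<^sub>M Q) Z" if "Z \<in> sets (P \<Otimes>\<^sub>M Q)" for Z
    using Int_stable_pair_measure_generator[of P Q] pair_measure_closed[of P Q] that[unfolded sets_pair_measure]
  proof (induct rule: sigma_sets_induct_disjoint)
    case (basic Z)
    then show ?case using rect by auto
  next
    case empty
    then show ?case by simp
  next
    case (compl Z)
    then have Z: "Z \<in> sets (P \<Otimes>\<^sub>M Q)" "Z \<in> sets N" "Z \<in> sets N'"
      using sets_N sets_N' by (auto simp: sets_pair_measure)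
    have top: "measure N (space P \<times> space Q) + measure N' (space P \<times> space Q) = measure (P \<Otimes>\<^sub>M Q) (space P \<times> space Q)"
      using rect[of "space P" "space Q"]
      by (simp add: finite_measure.emeasure_eq_measure[OF fN] finite_measure.emeasure_eq_measure[OF fN']
          PQ.emeasure_eq_measure flip: ennreal_plus)
    have "measure N Z + measure N' Z = measure (P \<Otimes>\<^sub>M Q) Z"
      using compl(2)
      by (simp add: finite_measure.emeasure_eq_measure[OF fN] finite_measure.emeasure_eq_measure[OF fN']
          PQ.emeasure_eq_measure flip: ennreal_plus)
    then have "measure N (space P \<times> space Q - Z) + measure N' (space P \<times> space Q - Z) = measure (P \<Otimes>\<^sub>M Q) (space P \<times> space Q - Z)"
      using top PQ.finite_measure_compl[OF Z(1)] finite_measure.finite_measure_compl[OF fN Z(2)]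
        finite_measure.finite_measure_compl[OF fN' Z(3)] by (simp add: space_N space_pair_measure)
    then show ?case
      by (simp add: finite_measure.emeasure_eq_measure[OF fN] finite_measure.emeasure_eq_measure[OF fN']
          PQ.emeasure_eq_measure flip: ennreal_plus)
  next
    case (union Z)
    have Z: "range Z \<subseteq> sets (P \<Otimes>\<^sub>M Q)" "range Z \<subseteq> sets N" "range Z \<subseteq> sets N'"
      using union(2) sets_N sets_N' by (auto simp: sets_pair_measure)
    have "emeasure N (\<Union>i. Z i) + emeasure N' (\<Union>i. Z i) = (\<Sum>i. emeasure N (Z i)) + (\<Sum>i. emeasure N' (Z i))"
      using suminf_emeasure[OF Z(2) union(1)] suminf_emeasure[OF Z(3) union(1)] by simp
    also have "\<dots> = (\<Sum>i. emeasure N (Z i) + emeasure N' (Z i))"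
      by (intro suminf_add) auto
    also have "\<dots> = emeasure (P \<Otimes>\<^sub>M Q) (\<Union>i. Z i)"
      using union(3) suminf_emeasure[OF Z(1) union(1)] by simp
    finally show ?case .
  qed
  then have N_le: "emeasure N Z \<le> emeasure (P \<Otimes>\<^sub>M Q) Z" if "Z \<in> sets (P \<Otimes>\<^sub>M Q)" for Z
    using that by (metis le_iff_add)
  have "absolutely_continuous (P \<Otimes>\<^sub>M Q) N"
    unfolding absolutely_continuous_def using N_le sets_N by (fastforce simp: null_sets_def)
  from PQ.Radon_Nikodym[OF this sets_N]
  obtain d where d [measurable]: "d \<in> borel_measurable (P \<Otimes>\<^sub>M Q)" and dN: "density (P \<Otimes>\<^sub>M Q) d = N"
    by auto
  \<comment> \<open>Compare \<open>N\<close> with the product measure on the set \<open>Z\<close>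
    where the density exceeds 1: the excess \<open>d - 1\<close> must integrate to 0 over
    \<open>Z\<close>.\<close>
  have d_le: "AE z in P \<Otimes>\<^sub>M Q. d z \<le> 1"
  proof -
    define Z where "Z = {z\<in>space (P \<Otimes>\<^sub>M Q). 1 < d z}"
    have [measurable]: "Z \<in> sets (P \<Otimes>\<^sub>M Q)" unfolding Z_def by measurable
    have "(\<integral>\<^sup>+z. d z * indicator Z z \<partial>(P \<Otimes>\<^sub>M Q)) \<le> emeasure (P \<Otimes>\<^sub>M Q) Z"
      using N_le[of Z] unfolding dN[symmetric] by (simp add: emeasure_density)
    moreover have "(\<integral>\<^sup>+z. d z * indicator Z z \<partial>(P \<Otimes>\<^sub>M Q))
       = (\<integral>\<^sup>+z. indicator Z z + (d z - 1) * indicator Z z \<partial>(P \<Otimes>\<^sub>M Q))"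
    proof (intro nn_integral_cong)
      fix z
      have "d z = 1 + (d z - 1)" if "z \<in> Z"
      proof -
        have "1 \<le> d z" using that by (auto simp: Z_def)
        from diff_add_cancel_ennreal[OF this] show ?thesis by (metis add.commute)
      qed
      then show "d z * indicator Z z = indicator Z z + (d z - 1) * indicator Z z"
        by (cases "z \<in> Z") auto
    qed
    moreover have "\<dots> = emeasure (P \<Otimes>\<^sub>M Q) Z + (\<integral>\<^sup>+z. (d z - 1) * indicator Z z \<partial>(P \<Otimes>\<^sub>M Q))"
      by (subst nn_integral_add) auto
    ultimately have "emeasure (P \<Otimes>\<^sub>M Q) Z + (\<integral>\<^sup>+z. (d z - 1) * indicator Z z \<partial>(P \<Otimes>\<^sub>M Q))
        \<le> emeasure (P \<Otimes>\<^sub>M Q) Z + 0"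
      by (simp only: add_0_right)
    then have "(\<integral>\<^sup>+z. (d z - 1) * indicator Z z \<partial>(P \<Otimes>\<^sub>M Q)) = 0"
      unfolding ennreal_add_left_cancel_le using PQ.emeasure_finite[of Z] by simp
    then have "AE z in P \<Otimes>\<^sub>M Q. (d z - 1) * indicator Z z = 0"
      by (subst (asm) nn_integral_0_iff_AE) auto
    with AE_space show ?thesis
    proof eventually_elim
      case (elim z)
      show ?case
      proof (rule ccontr)
        assume "\<not> d z \<le> 1"
        then have "1 < d z" "z \<in> Z" using elim by (auto simp: Z_def)
        then show False using elim(2) by (auto simp: diff_eq_0_iff_ennreal)
      qed
    qed
  qed
  \<comment> \<open>Truncation turns the a.e. bound into one valid at every point, so that
    \<open>k\<close> is bounded everywhere.\<close>
  define g where "g z = enn2real (min 1 (d z))" for z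
  have g [measurable]: "g \<in> borel_measurable (P \<Otimes>\<^sub>M Q)"
    unfolding g_def by measurable
  have g01: "0 \<le> g z" "g z \<le> 1" for z
    unfolding g_def by (auto intro: enn2real_leI)
  have dg: "AE z in P \<Otimes>\<^sub>M Q. d z = ennreal (g z)"
    using d_le
  proof eventually_elim
    case (elim z)
    then have "min 1 (d z) = d z" "d z < top"
      by (auto simp: min_def intro: le_less_trans)
    then show ?case by (simp add: g_def)
  qed
  have intg: "integrable Q (\<lambda>y. g (x, y) * indicator B y)" if "x \<in> space P" and [measurable]: "B \<in> sets Q" for x B
  proof (rule Q.integrable_const_bound[where B=1])
    have [measurable]: "(\<lambda>y. g (x, y)) \<in> borel_measurable Q"
      using that(1) by measurable
    show "(\<lambda>y. g (x, y) * indicator B y) \<in> borel_measurable Q" by measurable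
    show "AE y in Q. norm (g (x, y) * indicator B y) \<le> 1"
      using g01 by (auto split: split_indicator)
  qed
  have repr: "AE x in P. (measure Q B + S B x) / 2 = (\<integral>y. g (x, y) * indicator B y \<partial>Q)"
    if [measurable]: "B \<in> sets Q" for B
  proof -
    \<comment> \<open>For fixed \<open>B\<close> both sides are densities with respect to
      \<open>P\<close>; over each \<open>A\<close> both integrate to the \<open>N\<close> measure of
      \<open>A \<times> B\<close>.\<close>
    have "AE x in P. ennreal ((measure Q B + S B x) / 2) = (\<integral>\<^sup>+y. ennreal (g (x, y) * indicator B y) \<partial>Q)"
    proof (rule P.density_unique_finite_measure)
      fix A assume [measurable]: "A \<in> sets P"
      have "(\<integral>\<^sup>+x. ennreal ((measure Q B + S B x) / 2) * indicator A x \<partial>P) = emeasure N (A \<times> B)"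
        by (simp add: N)
      also have "\<dots> = (\<integral>\<^sup>+z. d z * indicator (A \<times> B) z \<partial>(P \<Otimes>\<^sub>M Q))"
        unfolding dN[symmetric] by (subst emeasure_density) auto
      also have "\<dots> = (\<integral>\<^sup>+z. ennreal (g z) * indicator (A \<times> B) z \<partial>(P \<Otimes>\<^sub>M Q))"
        using dg by (intro nn_integral_cong_AE) auto
      also have "\<dots> = (\<integral>\<^sup>+x. \<integral>\<^sup>+y. ennreal (g (x, y)) * indicator (A \<times> B) (x, y) \<partial>Q \<partial>P)"
        by (rule Q.nn_integral_fst[symmetric]) measurable
      also have "\<dots> = (\<integral>\<^sup>+x. (\<integral>\<^sup>+y. ennreal (g (x, y) * indicator B y) \<partial>Q) * indicator A x \<partial>P)"
        by (auto intro!: nn_integral_cong split: split_indicator)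
      finally show "(\<integral>\<^sup>+x. ennreal ((measure Q B + S B x) / 2) * indicator A x \<partial>P)
         = (\<integral>\<^sup>+x. (\<integral>\<^sup>+y. ennreal (g (x, y) * indicator B y) \<partial>Q) * indicator A x \<partial>P)" .
    qed measurable
    with AE_space bnd[OF that] show ?thesis
    proof eventually_elim
      case (elim x)
      have "(\<integral>\<^sup>+y. ennreal (g (x, y) * indicator B y) \<partial>Q) = ennreal (\<integral>y. g (x, y) * indicator B y \<partial>Q)"
        using intg[OF elim(1) that] g01 by (intro nn_integral_eq_integral) auto
      moreover have "0 \<le> (\<integral>y. g (x, y) * indicator B y \<partial>Q)"
        using g01 by (intro integral_nonneg_AE) auto
      ultimately show ?case
        using elim by (auto simp: abs_le_iff)
    qed
  qed
  show ?thesis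
  proof (rule that[of "\<lambda>z. 2 * g z - 1"])
    show "\<bar>2 * g z - 1\<bar> \<le> 1" for z
      using g01[of z] by auto
    fix B assume B [measurable]: "B \<in> sets Q"
    have [simp]: "integrable Q (indicator B :: 'b \<Rightarrow> real)"
      by (intro integrable_real_indicator) (auto simp: less_top[symmetric])
    from AE_space repr[OF B] show "AE x in P. S B x = (\<integral>y. (2 * g (x, y) - 1) * indicator B y \<partial>Q)"
    proof eventually_elim
      case (elim x)
      have "(\<integral>y. (2 * g (x, y) - 1) * indicator B y \<partial>Q) = (\<integral>y. 2 * (g (x, y) * indicator B y) - indicator B y \<partial>Q)"
        by (simp add: algebra_simps)
      also have "\<dots> = 2 * (\<integral>y. g (x, y) * indicator B y \<partial>Q) - measure Q B"
        using intg[OF elim(1) B] by (subst Bochner_Integration.integral_diff) auto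
      finally show ?case using elim(2) by simp
    qed
  qed measurable
qed

section \<open>Smoothing from weighted \<open>L\<^sup>1\<close> bounds\<close>

text \<open>The time variable is \<open>t = s (1/2 + r)\<close>; a priori boundedness of \<open>b\<close> is what makes the absorption argument legitimate.\<close>

lemma iterated_smoothing_bound:
  fixes L \<gamma> \<alpha> l\<^sub>0 :: real
  assumes L: "0 < L" and \<gamma>: "0 < \<gamma>" and \<alpha>: "0 \<le> \<alpha>" and l\<^sub>0: "0 < l\<^sub>0"
  obtains C where "0 \<le> C"
    "\<And>b D U. \<lbrakk>0 \<le> D; \<And>r. 0 < r \<Longrightarrow> r \<le> 1/2 \<Longrightarrow> 0 \<le> b r \<and> b r \<le> U;
       \<And>r l. 0 < r \<Longrightarrow> r \<le> 1/2 \<Longrightarrow> 0 < l \<Longrightarrow> l \<le> l\<^sub>0 \<Longrightarrow>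
          b r \<le> D * l powr (-1 - \<gamma>) + L * l powr \<gamma> * r powr (-\<alpha>) * b (r / 2)\<rbrakk>
       \<Longrightarrow> b (1/4) \<le> C * (D::real)"
proof -
  \<comment> \<open>The rate at which \<open>b r\<close> may blow up as \<open>r\<close> tends to 0:
    with \<open>l = \<epsilon> * r powr (\<alpha> / \<gamma>)\<close> the first term of the
    recursion becomes a multiple of \<open>r powr (-\<beta>)\<close>.\<close>
  define \<beta> where "\<beta> = (1 + \<gamma>) * \<alpha> / \<gamma>"
  \<comment> \<open>Small enough for the recursive term to carry at most the factor 1/2;
    \<open>2 powr \<beta>\<close> is the cost of passing from \<open>r\<close> to
    \<open>r / 2\<close> in the weight.\<close>
  define \<epsilon> where "\<epsilon> = min l\<^sub>0 ((1 / (2 * L * 2 powr \<beta>)) powr (1 / \<gamma>))"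
  have \<beta>: "0 \<le> \<beta>" using \<gamma> \<alpha> by (simp add: \<beta>_def)
  have \<epsilon>: "0 < \<epsilon>" "\<epsilon> \<le> l\<^sub>0" using l\<^sub>0 L by (auto simp: \<epsilon>_def)
  have "\<epsilon> powr \<gamma> \<le> ((1 / (2 * L * 2 powr \<beta>)) powr (1 / \<gamma>)) powr \<gamma>"
    using \<epsilon> \<gamma> by (intro powr_mono2) (auto simp: \<epsilon>_def)
  also have "\<dots> = 1 / (2 * L * 2 powr \<beta>)"
    using \<gamma> L by (simp add: powr_powr)
  finally have \<epsilon>\<gamma>: "L * \<epsilon> powr \<gamma> * 2 powr \<beta> \<le> 1 / 2"
    using L by (simp add: field_simps)
  \<comment> \<open>In the constant, \<open>4 powr \<beta>\<close> undoes the weight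
    \<open>r powr \<beta>\<close> at \<open>r = 1/4\<close>, and the factor 2 comes from absorbing
    \<open>F / 2\<close>.\<close>
  show ?thesis
  proof (rule that[of "4 powr \<beta> * (2 * \<epsilon> powr (-1 - \<gamma>))"])
    show "0 \<le> 4 powr \<beta> * (2 * \<epsilon> powr (-1 - \<gamma>))" by simp
    fix b :: "real \<Rightarrow> real" and D U
    assume D: "0 \<le> D" and bU: "\<And>r. 0 < r \<Longrightarrow> r \<le> 1/2 \<Longrightarrow> 0 \<le> b r \<and> b r \<le> U"
      and step: "\<And>r l. 0 < r \<Longrightarrow> r \<le> 1/2 \<Longrightarrow> 0 < l \<Longrightarrow> l \<le> l\<^sub>0 \<Longrightarrow>
          b r \<le> D * l powr (-1 - \<gamma>) + L * l powr \<gamma> * r powr (-\<alpha>) * b (r / 2)"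
    define F where "F = (SUP r\<in>{0<..1/2}. r powr \<beta> * b r)"
    have bdd: "bdd_above ((\<lambda>r. r powr \<beta> * b r) ` {0<..1/2})"
    proof (rule bdd_aboveI2)
      fix r :: real assume r: "r \<in> {0<..1/2}"
      have "r powr \<beta> \<le> 1"
        using r \<beta> by (intro powr_le1) auto
      then have "r powr \<beta> * b r \<le> 1 * U"
        using bU[of r] r by (intro mult_mono) auto
      then show "r powr \<beta> * b r \<le> U" by simp
    qed
    have le_F: "r powr \<beta> * b r \<le> F" if "0 < r" "r \<le> 1/2" for r
      unfolding F_def using that by (intro cSUP_upper bdd) auto
    have "r powr \<beta> * b r \<le> D * \<epsilon> powr (-1 - \<gamma>) + F / 2" if r: "0 < r" "r \<le> 1/2" for r
    proof -
      \<comment> \<open>This power of \<open>r\<close> cancels \<open>r powr (-\<alpha>)\<close> in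
        the recursive term.\<close>
      define l where "l = \<epsilon> * r powr (\<alpha> / \<gamma>)"
      have "r powr (\<alpha> / \<gamma>) \<le> 1"
        using r \<alpha> \<gamma> by (intro powr_le1) auto
      then have l: "0 < l" "l \<le> l\<^sub>0"
        using \<epsilon> r mult_mono[of \<epsilon> l\<^sub>0 "r powr (\<alpha> / \<gamma>)" 1] l\<^sub>0 by (auto simp: l_def)
      have l1: "l powr (-1 - \<gamma>) = \<epsilon> powr (-1 - \<gamma>) * r powr (-\<beta>)"
      proof -
        have "\<alpha> / \<gamma> * (-1 - \<gamma>) = - \<beta>"
          using \<gamma> by (simp add: \<beta>_def field_simps)
        then show ?thesis
          using \<epsilon> r by (simp add: l_def powr_mult powr_powr)
      qed
      have l2: "l powr \<gamma> * r powr (-\<alpha>) = \<epsilon> powr \<gamma>"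
        using \<epsilon> r \<gamma> by (simp add: l_def powr_mult powr_powr powr_minus field_simps)
      have "b r \<le> D * l powr (-1 - \<gamma>) + L * (l powr \<gamma> * r powr (-\<alpha>)) * b (r / 2)"
        using step[OF r l] by (simp add: mult.assoc)
      then have "r powr \<beta> * b r \<le> r powr \<beta> * (D * (\<epsilon> powr (-1 - \<gamma>) * r powr (-\<beta>)) + L * \<epsilon> powr \<gamma> * b (r / 2))"
        unfolding l1 l2 by (intro mult_left_mono) auto
      also have "\<dots> = D * \<epsilon> powr (-1 - \<gamma>) + (L * \<epsilon> powr \<gamma> * 2 powr \<beta>) * ((r / 2) powr \<beta> * b (r / 2))"
        using r by (simp add: powr_divide powr_minus field_simps)
      also have "\<dots> \<le> D * \<epsilon> powr (-1 - \<gamma>) + 1/2 * F"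
      proof (intro add_left_mono mult_mono)
        show "0 \<le> (r / 2) powr \<beta> * b (r / 2)" using bU[of "r/2"] r by simp
        show "(r / 2) powr \<beta> * b (r / 2) \<le> F" using le_F[of "r/2"] r by simp
      qed (use \<epsilon>\<gamma> in auto)
      finally show ?thesis by simp
    qed
    then have "F \<le> D * \<epsilon> powr (-1 - \<gamma>) + F / 2"
      unfolding F_def by (intro cSUP_least) auto
    then have "F \<le> 2 * (D * \<epsilon> powr (-1 - \<gamma>))" by simp
    with le_F[of "1/4"] have "(1/4) powr \<beta> * b (1/4) \<le> 2 * (D * \<epsilon> powr (-1 - \<gamma>))"
      by simp
    then have "4 powr \<beta> * ((1/4) powr \<beta> * b (1/4)) \<le> 4 powr \<beta> * (2 * (D * \<epsilon> powr (-1 - \<gamma>)))"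
      by (intro mult_left_mono) auto
    then show "b (1/4) \<le> 4 powr \<beta> * (2 * \<epsilon> powr (-1 - \<gamma>)) * D"
      by (simp add: powr_divide mult_ac)
  qed
qed

section \<open>L^2 norms as real numbers, and L^p membership from norm bounds\<close>

definition l2norm :: "'a measure \<Rightarrow> ('a \<Rightarrow> complex) \<Rightarrow> real" where
  "l2norm M f = sqrt (\<integral>x. (cmod (f x))\<^sup>2 \<partial>M)"

lemma norm_powr_2: "norm x powr 2 = (norm x)\<^sup>2"
  by (cases "x = 0") (auto simp: powr_numeral)

lemma memLp_2_iff:
  "memLp M 2 f \<longleftrightarrow> f \<in> borel_measurable M \<and> integrable M (\<lambda>x. (norm (f x))\<^sup>2)"
  by (simp add: memLp_def norm_powr_2)

lemma memLp_1_iff: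
  fixes f :: "'a \<Rightarrow> 'b::{banach, second_countable_topology}"
  shows "memLp M 1 f \<longleftrightarrow> integrable M f"
  by (auto simp: memLp_def integrable_norm_iff)

text \<open>Membership is essential: off L^2 the value of \<open>Lnorm\<close> is infinite, whereas
  \<open>l2norm\<close> is always a real number.\<close>

lemma Lnorm_2: "memLp M 2 f \<Longrightarrow> Lnorm M 2 f = ennreal (l2norm M f)"
  by (auto simp: Lnorm_def memLp_def norm_powr_2 l2norm_def powr_half_sqrt)

lemma Lnorm_1:
  fixes f :: "'a \<Rightarrow> 'b::{banach, second_countable_topology}"
  shows "integrable M f \<Longrightarrow> Lnorm M 1 f = ennreal (\<integral>x. norm (f x) \<partial>M)"
  by (auto simp: Lnorm_def)

text \<open>\<open>Lnorm\<close> is infinite off L^p, so a finite bound carries measurability and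
  integrability with it. This is how (B11), (B23) and (B3) yield integrable functions.\<close>

lemma memLp_if_Lnorm_le: "Lnorm M p f \<le> ennreal r \<Longrightarrow> memLp M p f"
  by (auto simp: Lnorm_def memLp_def top_unique split: if_splits)

lemma l2norm_nonneg [simp]: "0 \<le> l2norm M f"
  by (simp add: l2norm_def)

text \<open>The infimum of the essential bounds is approached along a sequence, and countably many
  exceptional null sets have a null union; hence the infimum is itself an essential bound.\<close>

lemma AE_le_Linf_norm:
  assumes "Linf_norm M f \<le> ennreal r" "0 \<le> r"
  shows "AE x in M. norm (f x) \<le> r"
proof -
  have "AE x in M. norm (f x) \<le> r + 1 / real (Suc n)" for n
  proof -
    have "Linf_norm M f < ennreal (r + 1 / real (Suc n))"
      using assms by (intro le_less_trans[OF assms(1)] ennreal_lessI) (auto intro: add_nonneg_pos)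
    then obtain C where C: "AE x in M. ennreal (norm (f x)) \<le> C" "C < ennreal (r + 1 / real (Suc n))"
      unfolding Linf_norm_def Inf_less_iff by auto
    from C(1) show ?thesis
    proof eventually_elim
      case (elim x)
      then have "ennreal (norm (f x)) \<le> ennreal (r + 1 / real (Suc n))"
        using C(2) by simp
      then show ?case
        using assms(2) by (subst (asm) ennreal_le_iff) auto
    qed
  qed
  then have "AE x in M. \<forall>n. norm (f x) \<le> r + 1 / real (Suc n)"
    by (subst AE_all_countable) auto
  then show ?thesis
  proof eventually_elim
    case (elim x)
    have "(\<lambda>n. r + 1 / real (Suc n)) \<longlonglongrightarrow> r + 0"
      by (intro tendsto_intros LIMSEQ_Suc lim_1_over_n)
    then show ?case
      using elim by (intro LIMSEQ_le_const[of _ r]) auto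
  qed
qed

lemma contraction_C0_semigroup_memLp:
  assumes "contraction_C0_semigroup M T" "0 \<le> t" "memLp M 2 f"
  shows "memLp M 2 (T t f)" "l2norm M (T t f) \<le> l2norm M f"
proof -
  have le: "Lnorm M 2 (T t f) \<le> ennreal (l2norm M f)"
    using assms by (auto simp: contraction_C0_semigroup_def Lnorm_2)
  then show *: "memLp M 2 (T t f)" by (rule memLp_if_Lnorm_le)
  show "l2norm M (T t f) \<le> l2norm M f"
    using le by (simp add: Lnorm_2[OF *])
qed

text \<open>On \<open>E\<close> the square of \<open>cmod (u x)\<close> is at most
  \<open>B / l * (w x * cmod (u x))\<close>, off \<open>E\<close> at most the square of
  \<open>B\<close>. The free parameter \<open>\<eta>\<close> splits the product
  \<open>N * B / l\<close>, which makes the result linear in \<open>N\<close> and in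
  \<open>B\<close>. The set \<open>E\<close> stands in for the region where \<open>w\<close> is at
  least \<open>l\<close>, as \<open>w\<close> itself is not assumed measurable.\<close>

lemma l2norm_weighted_bound:
  assumes u: "memLp M 2 u" and B: "0 \<le> B" "AE x in M. cmod (u x) \<le> B"
    and w: "integrable M (\<lambda>x. w x * cmod (u x))" "(\<integral>x. w x * cmod (u x) \<partial>M) \<le> N"
    and w0: "\<And>x. 0 \<le> w x" and E: "E \<in> sets M" "\<And>x. x \<in> E \<Longrightarrow> l \<le> w x" and l: "0 < l"
    and d: "emeasure M (space M - E) \<le> ennreal (d\<^sup>2)" "0 \<le> d" and \<eta>: "0 < \<eta>"
  shows "l2norm M u \<le> N / (l * \<eta>) + (\<eta> + d) * B"
proof -
  have u': "u \<in> borel_measurable M" "integrable M (\<lambda>x. (cmod (u x))\<^sup>2)"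
    using u by (auto simp: memLp_2_iff)
  define I where "I = (\<integral>x. w x * cmod (u x) \<partial>M)"
  have I: "0 \<le> I" "I \<le> N"
    using w(2) w0 by (auto simp: I_def)
  have "ennreal (\<integral>x. (cmod (u x))\<^sup>2 \<partial>M) = (\<integral>\<^sup>+x. ennreal ((cmod (u x))\<^sup>2) \<partial>M)"
    using u' by (intro nn_integral_eq_integral[symmetric]) auto
  also have "\<dots> \<le> (\<integral>\<^sup>+x. ennreal (B / l) * ennreal (w x * cmod (u x)) + ennreal (B\<^sup>2) * indicator (space M - E) x \<partial>M)"
  proof (rule nn_integral_mono_AE)
    show "AE x in M. ennreal ((cmod (u x))\<^sup>2) \<le> ennreal (B / l) * ennreal (w x * cmod (u x)) + ennreal (B\<^sup>2) * indicator (space M - E) x"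
      using B(2) AE_space
    proof eventually_elim
      case (elim x)
      show ?case
      proof (cases "x \<in> E")
        case True
        have "l * (cmod (u x))\<^sup>2 \<le> w x * (B * cmod (u x))"
          unfolding power2_eq_square using elim E(2)[OF True] l w0 B(1) by (intro mult_mono) auto
        then have "(cmod (u x))\<^sup>2 \<le> B / l * (w x * cmod (u x))"
          using l by (simp add: field_simps)
        then have "ennreal ((cmod (u x))\<^sup>2) \<le> ennreal (B / l * (w x * cmod (u x)))"
          by (rule ennreal_leI)
        also have "\<dots> = ennreal (B / l) * ennreal (w x * cmod (u x))"
          using B l w0 by (intro ennreal_mult) auto
        finally show ?thesis by (simp add: True)
      next
        case False
        have "ennreal ((cmod (u x))\<^sup>2) \<le> ennreal (B\<^sup>2)"
          using elim by (intro ennreal_leI power_mono) auto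
        then show ?thesis
          using False elim(2) by (simp add: add_increasing)
      qed
    qed
  qed
  also have "\<dots> = ennreal (B / l) * (\<integral>\<^sup>+x. ennreal (w x * cmod (u x)) \<partial>M) + ennreal (B\<^sup>2) * emeasure M (space M - E)"
    using E w(1) by (subst nn_integral_add) (auto simp: nn_integral_cmult nn_integral_cmult_indicator)
  also have "\<dots> \<le> ennreal (B / l) * ennreal N + ennreal (B\<^sup>2) * ennreal (d\<^sup>2)"
  proof (intro add_mono mult_left_mono d)
    have "(\<integral>\<^sup>+x. ennreal (w x * cmod (u x)) \<partial>M) = ennreal I"
      unfolding I_def using w0 by (intro nn_integral_eq_integral w) auto
    then show "(\<integral>\<^sup>+x. ennreal (w x * cmod (u x)) \<partial>M) \<le> ennreal N"
      using I by (simp add: ennreal_leI)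
  qed auto
  also have "\<dots> = ennreal (B / l * N + B\<^sup>2 * d\<^sup>2)"
  proof -
    have nonneg: "0 \<le> B / l" "0 \<le> N" using B l I by auto
    have "ennreal (B / l) * ennreal N = ennreal (B / l * N)"
      using nonneg by (rule ennreal_mult[symmetric])
    moreover have "ennreal (B\<^sup>2) * ennreal (d\<^sup>2) = ennreal (B\<^sup>2 * d\<^sup>2)"
      by (rule ennreal_mult[symmetric]) auto
    moreover have "ennreal (B / l * N) + ennreal (B\<^sup>2 * d\<^sup>2) = ennreal (B / l * N + B\<^sup>2 * d\<^sup>2)"
      using nonneg by (intro ennreal_plus[symmetric] mult_nonneg_nonneg) auto
    ultimately show ?thesis by simp
  qed
  finally have "(\<integral>x. (cmod (u x))\<^sup>2 \<partial>M) \<le> B / l * N + B\<^sup>2 * d\<^sup>2"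
    using B l I by (subst (asm) ennreal_le_iff) auto
  also have "\<dots> = N / (l * \<eta>) * (\<eta> * B) + (d * B)\<^sup>2"
    using l \<eta> by (simp add: field_simps power_mult_distrib)
  also have "\<dots> \<le> (N / (l * \<eta>) + \<eta> * B + d * B)\<^sup>2"
  proof -
    have sq: "p * q + r\<^sup>2 \<le> (p + q + r)\<^sup>2" if "0 \<le> p" "0 \<le> q" "0 \<le> r" for p q r :: real
    proof -
      have "(p + q + r)\<^sup>2 = p * q + r\<^sup>2 + (p\<^sup>2 + q\<^sup>2 + p * q + 2 * p * r + 2 * q * r)"
        by (simp add: power2_eq_square algebra_simps)
      moreover have "0 \<le> p\<^sup>2 + q\<^sup>2 + p * q + 2 * p * r + 2 * q * r"
        using that by (intro add_nonneg_nonneg mult_nonneg_nonneg) auto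
      ultimately show ?thesis by linarith
    qed
    show ?thesis
      by (rule sq) (use l \<eta> B d I in auto)
  qed
  finally have "l2norm M u \<le> N / (l * \<eta>) + \<eta> * B + d * B"
    unfolding l2norm_def using l \<eta> B d I by (intro real_le_lsqrt) auto
  then show ?thesis by (simp add: algebra_simps)
qed

text \<open>With \<open>b r\<close> the L^2 norm at time \<open>s / 2 + r * s\<close>, the preceding
  estimate between \<open>r / 2\<close> and \<open>r\<close> is the recursion of
  \<open>iterated_smoothing_bound\<close>. The factor \<open>s powr \<alpha>\<close> in the measure
  bound cancels the powers of \<open>s\<close> in the recursive term, so that \<open>C\<close> is
  uniform in \<open>s\<close>, \<open>w\<close>, \<open>f\<close> and \<open>N\<close>.\<close>

lemma weighted_L1_bound_imp_sup_bound:
  fixes \<alpha> c \<gamma> m l\<^sub>0 :: real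
  assumes sg: "contraction_C0_semigroup M T"
    and const: "0 \<le> \<alpha>" "0 \<le> c" "0 < \<gamma>" "0 \<le> m" "0 < l\<^sub>0"
    and sup: "\<And>t f. 0 < t \<Longrightarrow> memLp M 2 f \<Longrightarrow>
                Linf_norm M (T t f) \<le> ennreal (c * t powr (- \<alpha>)) * Lnorm M 2 f"
  obtains C where "0 \<le> C"
    "\<And>s w f N. \<lbrakk>0 < s; memLp M 2 f; \<And>x. 0 \<le> w x; 0 \<le> N;
       \<And>t. s / 2 \<le> t \<Longrightarrow> t \<le> s \<Longrightarrow> integrable M (\<lambda>x. w x * cmod (T t f x)) \<and>
          (\<integral>x. w x * cmod (T t f x) \<partial>M) \<le> N;
       \<And>l. 0 < l \<Longrightarrow> l \<le> l\<^sub>0 \<Longrightarrow> \<exists>E\<in>sets M. (\<forall>x\<in>E. l \<le> w x) \<and>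
          emeasure M (space M - E) \<le> ennreal ((m * l powr \<gamma> * s powr \<alpha>)\<^sup>2)\<rbrakk>
       \<Longrightarrow> AE x in M. cmod (T s f x) \<le> C * s powr (- 2 * \<alpha>) * N"
proof -
  have sup': "AE x in M. cmod (T t f x) \<le> c * t powr (- \<alpha>) * l2norm M f" if "0 < t" "memLp M 2 f" for t f
  proof (rule AE_le_Linf_norm)
    show "Linf_norm M (T t f) \<le> ennreal (c * t powr (- \<alpha>) * l2norm M f)"
      using sup[OF that] const that by (simp add: Lnorm_2 ennreal_mult)
  qed (use const in auto)
  have semi: "AE x in M. T (s + t) f x = T s (T t f) x" if "0 \<le> s" "0 \<le> t" "memLp M 2 f" for s t f
    using sg that by (auto simp: contraction_C0_semigroup_def)
  \<comment> \<open>\<open>c + 1\<close> in place of \<open>c\<close> keeps \<open>L\<close>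
    positive even for \<open>c = 0\<close>.\<close>
  define L where "L = (1 + m) * ((c + 1) * 2 powr \<alpha>)"
  have L: "0 < L" using const by (auto simp: L_def intro!: mult_pos_pos)
  obtain C where C: "0 \<le> C"
    "\<And>b D U. \<lbrakk>0 \<le> D; \<And>r. 0 < r \<Longrightarrow> r \<le> 1/2 \<Longrightarrow> 0 \<le> b r \<and> b r \<le> U;
       \<And>r l. 0 < r \<Longrightarrow> r \<le> 1/2 \<Longrightarrow> 0 < l \<Longrightarrow> l \<le> l\<^sub>0 \<Longrightarrow>
          b r \<le> D * l powr (-1 - \<gamma>) + L * l powr \<gamma> * r powr (-\<alpha>) * b (r / 2)\<rbrakk>
       \<Longrightarrow> b (1/4) \<le> C * (D::real)"
    using iterated_smoothing_bound[OF L const(3,1,5)] by metis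
  show ?thesis
  proof (rule that[of "c * 4 powr \<alpha> * C"])
    show "0 \<le> c * 4 powr \<alpha> * C" using const C by simp
    fix s w f N
    assume s: "0 < s" and f: "memLp M 2 f" and w0: "\<And>x. 0 \<le> w x" and N: "0 \<le> N"
      and w: "\<And>t. s / 2 \<le> t \<Longrightarrow> t \<le> s \<Longrightarrow> integrable M (\<lambda>x. w x * cmod (T t f x)) \<and>
          (\<integral>x. w x * cmod (T t f x) \<partial>M) \<le> N"
      and E: "\<And>l. 0 < l \<Longrightarrow> l \<le> l\<^sub>0 \<Longrightarrow> \<exists>E\<in>sets M. (\<forall>x\<in>E. l \<le> w x) \<and>
          emeasure M (space M - E) \<le> ennreal ((m * l powr \<gamma> * s powr \<alpha>)\<^sup>2)"
    define b where "b r = l2norm M (T (s / 2 + r * s) f)" for r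
    have "b (1/4) \<le> C * (N * s powr (- \<alpha>))"
    proof (rule C(2))
      show "0 \<le> N * s powr (- \<alpha>)" using N by simp
      \<comment> \<open>Contractivity supplies the a priori bound that absorption needs.\<close>
      show "0 \<le> b r \<and> b r \<le> l2norm M f" if "0 < r" "r \<le> 1/2" for r
        unfolding b_def using s that by (auto intro!: contraction_C0_semigroup_memLp[OF sg _ f])
      show "b r \<le> N * s powr (- \<alpha>) * l powr (-1 - \<gamma>) + L * l powr \<gamma> * r powr (- \<alpha>) * b (r / 2)"
        if r: "0 < r" "r \<le> 1/2" and l: "0 < l" "l \<le> l\<^sub>0" for r l
      proof -
        define v where "v = T (s / 2 + r / 2 * s) f"
        have v: "memLp M 2 v" "l2norm M v = b (r / 2)"
          unfolding v_def b_def using s r by (auto intro!: contraction_C0_semigroup_memLp[OF sg _ f])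
        \<comment> \<open>The sup bound after the time \<open>r * s / 2\<close> that separates
          \<open>v\<close> from the function being estimated.\<close>
        define B where "B = c * (r * s / 2) powr (- \<alpha>) * b (r / 2)"
        \<comment> \<open>Chosen so that the exceptional measure is at most the square of
          \<open>m * \<eta>\<close>; both parts of \<open>(\<eta> + m * \<eta>) * B\<close> then
          scale alike.\<close>
        define \<eta> where "\<eta> = l powr \<gamma> * s powr \<alpha>"
        have b0: "0 \<le> b (r / 2)" by (simp add: b_def)
        have B: "0 \<le> B" using const b0 by (simp add: B_def)
        have eq: "r * s / 2 + (s / 2 + r / 2 * s) = s / 2 + r * s" by (simp add: field_simps)
        have "AE x in M. T (s / 2 + r * s) f x = T (r * s / 2) v x"
          using semi[of "r * s / 2" "s / 2 + r / 2 * s" f] s r f unfolding eq v_def by simp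
        moreover have "AE x in M. cmod (T (r * s / 2) v x) \<le> B"
          using sup'[of "r * s / 2" v] s r v by (simp add: B_def)
        ultimately have ub: "AE x in M. cmod (T (s / 2 + r * s) f x) \<le> B"
          by eventually_elim simp
        have rs: "r * s \<le> 1/2 * s" using r s by (intro mult_right_mono) auto
        obtain E where E': "E \<in> sets M" "\<And>x. x \<in> E \<Longrightarrow> l \<le> w x"
            "emeasure M (space M - E) \<le> ennreal ((m * l powr \<gamma> * s powr \<alpha>)\<^sup>2)"
          using E[OF l] by blast
        have "b r \<le> N / (l * \<eta>) + (\<eta> + m * \<eta>) * B"
          unfolding b_def
        proof (rule l2norm_weighted_bound[where w=w and E=E])
          show "memLp M 2 (T (s / 2 + r * s) f)"
            using s r by (intro contraction_C0_semigroup_memLp[OF sg _ f]) auto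
          show "integrable M (\<lambda>x. w x * cmod (T (s / 2 + r * s) f x))"
            "(\<integral>x. w x * cmod (T (s / 2 + r * s) f x) \<partial>M) \<le> N"
            using w[of "s / 2 + r * s"] s r rs by auto
          show "emeasure M (space M - E) \<le> ennreal ((m * \<eta>)\<^sup>2)"
            using E'(3) by (simp add: \<eta>_def mult.assoc)
        qed (use B ub w0 E' l const s in \<open>auto simp: \<eta>_def\<close>)
        also have "N / (l * \<eta>) = N * s powr (- \<alpha>) * l powr (-1 - \<gamma>)"
        proof -
          have "l powr (-1 - \<gamma>) = 1 / (l * l powr \<gamma>)"
            using l by (simp add: powr_diff powr_minus field_simps)
          then show ?thesis by (simp add: \<eta>_def powr_minus field_simps)
        qed
        also have "(\<eta> + m * \<eta>) * B = (1 + m) * (c * 2 powr \<alpha>) * l powr \<gamma> * r powr (- \<alpha>) * b (r / 2)"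
        proof -
          have "(r * s / 2) powr (- \<alpha>) = r powr (- \<alpha>) * 2 powr \<alpha> / s powr \<alpha>"
            using r s by (simp add: powr_minus powr_mult powr_divide field_simps)
          then show ?thesis
            using s by (simp add: \<eta>_def B_def field_simps)
        qed
        also have "\<dots> \<le> L * l powr \<gamma> * r powr (- \<alpha>) * b (r / 2)"
          unfolding L_def using const b0 by (intro mult_right_mono mult_left_mono) auto
        finally show ?thesis by simp
      qed
    qed
    then have b4: "l2norm M (T (3 / 4 * s) f) \<le> C * (N * s powr (- \<alpha>))"
      by (simp add: b_def field_simps)
    have v: "memLp M 2 (T (3 / 4 * s) f)"
      using s by (intro contraction_C0_semigroup_memLp[OF sg _ f]) auto
    \<comment> \<open>The last quarter of the time is spent on passing from L^2 to the sup bound,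
      which contributes a second factor \<open>s powr (- \<alpha>)\<close>.\<close>
    have "AE x in M. T s f x = T (1 / 4 * s) (T (3 / 4 * s) f) x"
      using semi[of "1 / 4 * s" "3 / 4 * s" f] s f by (simp add: field_simps)
    moreover have "AE x in M. cmod (T (1 / 4 * s) (T (3 / 4 * s) f) x) \<le> c * (1 / 4 * s) powr (- \<alpha>) * l2norm M (T (3 / 4 * s) f)"
      using s by (intro sup' v) auto
    ultimately show "AE x in M. cmod (T s f x) \<le> c * 4 powr \<alpha> * C * s powr (- 2 * \<alpha>) * N"
    proof eventually_elim
      case (elim x)
      have "cmod (T s f x) \<le> c * (1 / 4 * s) powr (- \<alpha>) * l2norm M (T (3 / 4 * s) f)"
        using elim by simp
      also have "\<dots> \<le> c * (1 / 4 * s) powr (- \<alpha>) * (C * (N * s powr (- \<alpha>)))"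
        using b4 const by (intro mult_left_mono) auto
      also have "(1 / 4 * s) powr (- \<alpha>) = 4 powr \<alpha> * s powr (- \<alpha>)"
        using s by (simp add: powr_minus powr_mult powr_divide field_simps)
      also have "c * (4 powr \<alpha> * s powr (- \<alpha>)) * (C * (N * s powr (- \<alpha>))) = c * 4 powr \<alpha> * C * (s powr (- \<alpha>) * s powr (- \<alpha>)) * N"
        by (simp add: mult_ac)
      also have "s powr (- \<alpha>) * s powr (- \<alpha>) = s powr (- 2 * \<alpha>)"
        by (simp add: powr_add[symmetric])
      finally show ?case .
    qed
  qed
qed

section \<open>Kernels of operators from \<open>L\<^sup>1\<close> to \<open>L\<^sup>\<infinity>\<close>\<close>

lemma memLp_2_bounded:
  fixes f :: "'a \<Rightarrow> complex"
  assumes "memLp M 2 g" "f \<in> borel_measurable M" "AE x in M. norm (f x) \<le> norm (g x)"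
  shows "memLp M 2 f"
  unfolding memLp_2_iff
proof
  show "integrable M (\<lambda>x. (norm (f x))\<^sup>2)"
  proof (rule Bochner_Integration.integrable_bound)
    show "integrable M (\<lambda>x. (norm (g x))\<^sup>2)" using assms(1) by (simp add: memLp_2_iff)
    show "(\<lambda>x. (norm (f x))\<^sup>2) \<in> borel_measurable M" using assms(2) by measurable
    show "AE x in M. norm ((norm (f x))\<^sup>2) \<le> norm ((norm (g x))\<^sup>2)"
      using assms(3) by eventually_elim (simp add: power_mono)
  qed
qed fact

lemma memLp_2_add:
  fixes f g :: "'a \<Rightarrow> complex"
  assumes "memLp M 2 f" "memLp M 2 g"
  shows "memLp M 2 (\<lambda>x. f x + g x)"
  unfolding memLp_2_iff
proof
  have m [measurable]: "f \<in> borel_measurable M" "g \<in> borel_measurable M"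
    using assms by (auto simp: memLp_2_iff)
  show "(\<lambda>x. f x + g x) \<in> borel_measurable M" by measurable
  show "integrable M (\<lambda>x. (norm (f x + g x))\<^sup>2)"
  proof (rule Bochner_Integration.integrable_bound)
    show "integrable M (\<lambda>x. 2 * (norm (f x))\<^sup>2 + 2 * (norm (g x))\<^sup>2)"
      using assms by (auto simp: memLp_2_iff)
    show "AE x in M. norm ((norm (f x + g x))\<^sup>2) \<le> norm (2 * (norm (f x))\<^sup>2 + 2 * (norm (g x))\<^sup>2)"
    proof (rule AE_I2)
      fix x
      have "(norm (f x + g x))\<^sup>2 \<le> (norm (f x) + norm (g x))\<^sup>2"
        by (intro power_mono norm_triangle_ineq) auto
      also have "\<dots> \<le> 2 * (norm (f x))\<^sup>2 + 2 * (norm (g x))\<^sup>2"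
        using sum_squares_bound[of "norm (f x)" "norm (g x)"] by (simp add: power2_sum)
      finally show "norm ((norm (f x + g x))\<^sup>2) \<le> norm (2 * (norm (f x))\<^sup>2 + 2 * (norm (g x))\<^sup>2)"
        by simp
    qed
  qed measurable
qed

lemma memLp_2_cmult:
  fixes f :: "'a \<Rightarrow> complex"
  shows "memLp M 2 f \<Longrightarrow> memLp M 2 (\<lambda>x. a * f x)"
  by (auto simp: memLp_2_iff norm_mult power_mult_distrib)

text \<open>Truncation at 1 puts the square of \<open>h\<close> below \<open>h\<close>; products of
  \<open>h\<close> with bounded functions thus lie in L^1 and L^2 at once, even if \<open>M\<close>
  is infinite.\<close>

lemma (in sigma_finite_measure) positive_integrable_weight:
  obtains h :: "'a \<Rightarrow> real" where "h \<in> borel_measurable M" "\<And>x. 0 \<le> h x" "\<And>x. h x \<le> 1"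
    "\<And>x. x \<in> space M \<Longrightarrow> 0 < h x" "integrable M h"
proof -
  from Ex_finite_integrable_function obtain h0 where [measurable]: "h0 \<in> borel_measurable M"
    and fin: "integral\<^sup>N M h0 \<noteq> \<infinity>" and pos: "\<And>x. x \<in> space M \<Longrightarrow> 0 < h0 x \<and> h0 x < \<infinity>"
    by auto
  define h where "h x = enn2real (min 1 (h0 x))" for x
  have ennreal_h: "ennreal (h x) = min 1 (h0 x)" for x
    unfolding h_def by (rule ennreal_enn2real) (simp add: min_less_iff_disj)
  have [measurable]: "h \<in> borel_measurable M" unfolding h_def by measurable
  show ?thesis
  proof (rule that[of h])
    show "h x \<le> 1" for x unfolding h_def by (rule enn2real_leI) auto
    show "0 < h x" if "x \<in> space M" for x
      unfolding h_def enn2real_positive_iff using pos[OF that] by (auto simp: min_less_iff_disj)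
    show "integrable M h"
    proof (rule integrableI_nonneg)
      have "(\<integral>\<^sup>+x. ennreal (h x) \<partial>M) \<le> integral\<^sup>N M h0"
        unfolding ennreal_h by (intro nn_integral_mono) auto
      then show "(\<integral>\<^sup>+x. ennreal (h x) \<partial>M) < \<infinity>"
        using fin by (simp add: le_less_trans less_top)
    qed (auto simp: h_def)
  qed (auto simp: h_def)
qed

section \<open>Operators bounded pointwise by a weighted L^1 norm\<close>

locale dominated_operator = sigma_finite_measure M for M :: "'a measure" +
  fixes A :: "('a \<Rightarrow> complex) \<Rightarrow> ('a \<Rightarrow> complex)" and \<phi> :: "'a \<Rightarrow> real" and K :: real
  assumes \<phi> [measurable]: "\<phi> \<in> borel_measurable M" and \<phi>_nonneg: "\<And>x. 0 \<le> \<phi> x" and \<phi>_le: "\<And>x. \<phi> x \<le> K"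
    and A_meas: "\<And>f. memLp M 2 f \<Longrightarrow> A f \<in> borel_measurable M"
    and A_add: "\<And>f g. memLp M 2 f \<Longrightarrow> memLp M 2 g \<Longrightarrow> AE x in M. A (\<lambda>y. f y + g y) x = A f x + A g x"
    and A_scale: "\<And>f a. memLp M 2 f \<Longrightarrow> AE x in M. A (\<lambda>y. a * f y) x = a * A f x"
    and A_bound: "\<And>f. integrable M f \<Longrightarrow> memLp M 2 f \<Longrightarrow> AE x in M. cmod (A f x) \<le> (\<integral>y. \<phi> y * cmod (f y) \<partial>M)"
begin

lemma integrable_\<phi>_mult:
  fixes f :: "'a \<Rightarrow> complex"
  assumes "integrable M f" shows "integrable M (\<lambda>y. \<phi> y * cmod (f y))"
proof (rule Bochner_Integration.integrable_bound)
  show "integrable M (\<lambda>y. K * cmod (f y))" using assms by auto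
  show "AE y in M. norm (\<phi> y * cmod (f y)) \<le> norm (K * cmod (f y))"
    using \<phi>_nonneg order_trans[OF \<phi>_le abs_ge_self]
    by (intro AE_I2) (simp add: abs_mult mult_right_mono)
  have [measurable]: "f \<in> borel_measurable M" using assms by auto
  show "(\<lambda>y. \<phi> y * cmod (f y)) \<in> borel_measurable M" by measurable
qed

text \<open>The continuity behind the later approximation. It also shows that \<open>A\<close>
  respects a.e. equality on L^1 \<inter> L^2, which the locale does not postulate.\<close>

lemma A_diff_bound:
  assumes "integrable M f" "memLp M 2 f" "integrable M g" "memLp M 2 g"
  shows "AE x in M. cmod (A f x - A g x) \<le> (\<integral>y. \<phi> y * cmod (f y - g y) \<partial>M)"
proof -
  have m: "memLp M 2 (\<lambda>y. f y - g y)"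
    using memLp_2_add[OF assms(2) memLp_2_cmult[OF assms(4), of "-1"]] by simp
  have "AE x in M. A (\<lambda>y. g y + (f y - g y)) x = A g x + A (\<lambda>y. f y - g y) x"
    by (intro A_add assms m)
  moreover have "AE x in M. cmod (A (\<lambda>y. f y - g y) x) \<le> (\<integral>y. \<phi> y * cmod (f y - g y) \<partial>M)"
    using assms by (intro A_bound m) auto
  ultimately show ?thesis by eventually_elim simp
qed

text \<open>Multiplication by \<open>h\<close> replaces the \<sigma>-finite measure by finite ones:
  for \<open>h\<close> times the indicator of \<open>B\<close>, \<open>A_bound\<close> is domination
  by \<open>measure Q B\<close>. A kernel with respect to \<open>Q\<close> becomes one with respect
  to \<open>M\<close> after multiplication by \<open>\<phi> y * h y\<close>. \<open>F\<close> will
  be the real or the imaginary part.\<close>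

lemma kernel_on_indicators:
  fixes h :: "'a \<Rightarrow> real" and F :: "complex \<Rightarrow> real"
  assumes h [measurable]: "h \<in> borel_measurable M" and h_nonneg: "\<And>x. 0 \<le> h x"
    and h_pos: "\<And>x. x \<in> space M \<Longrightarrow> 0 < h x" and h_int: "integrable M h"
    and hB: "\<And>B. B \<in> sets M \<Longrightarrow> integrable M (\<lambda>y. complex_of_real (h y * indicator B y)) \<and>
               memLp M 2 (\<lambda>y. complex_of_real (h y * indicator B y))"
    and F [measurable]: "F \<in> borel_measurable borel" "\<And>u v. F (u + v) = F u + F v" "\<And>u. \<bar>F u\<bar> \<le> cmod u"
  obtains k where "k \<in> borel_measurable (M \<Otimes>\<^sub>M M)" "\<And>z. \<bar>k z\<bar> \<le> 1"
    "\<And>B. B \<in> sets M \<Longrightarrow> AE x in M. F (A (\<lambda>y. complex_of_real (h y * indicator B y)) x)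
       = (\<integral>y. k (x, y) * \<phi> y * (h y * indicator B y) \<partial>M)"
proof -
  define P where "P = density M (\<lambda>x. ennreal (h x))"
  define Q where "Q = density M (\<lambda>x. ennreal (\<phi> x * h x))"
  have sets [measurable_cong, simp]: "sets P = sets M" "sets Q = sets M"
    by (auto simp: P_def Q_def)
  have \<phi>h: "integrable M (\<lambda>x. \<phi> x * h x)"
    using integrable_\<phi>_mult[of "\<lambda>x. complex_of_real (h x)"] h_int h_nonneg by simp
  have fP: "finite_measure P"
    using h_int h_nonneg unfolding P_def
    by (auto intro!: finite_measureI simp: emeasure_density nn_integral_eq_integral cong: nn_integral_cong_simp)
  have fQ: "finite_measure Q"
    using \<phi>h h_nonneg \<phi>_nonneg unfolding Q_def
    by (auto intro!: finite_measureI simp: emeasure_density nn_integral_eq_integral cong: nn_integral_cong_simp)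
  have AE_P: "AE x in P. p x" if "AE x in M. p x" for p
    using that unfolding P_def by (subst AE_density) auto
  \<comment> \<open>As \<open>h\<close> is positive on the space, \<open>P\<close> has no null sets
    beyond those of \<open>M\<close>.\<close>
  have AE_M: "AE x in M. p x" if "AE x in P. p x" for p
    using that AE_space[of M] h_pos unfolding P_def
    by (subst (asm) AE_density) auto
  have mQ: "measure Q B = (\<integral>y. \<phi> y * cmod (complex_of_real (h y * indicator B y)) \<partial>M)" if [measurable]: "B \<in> sets M" for B
  proof -
    have "measure Q B = (\<integral>y. indicator B y \<partial>Q)"
      using sets.sets_into_space[OF that] by (simp add: Q_def Int_absorb2)
    also have "\<dots> = (\<integral>y. \<phi> y * h y * indicator B y \<partial>M)"
      unfolding Q_def using h_nonneg \<phi>_nonneg by (subst integral_real_density) auto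
    also have "\<dots> = (\<integral>y. \<phi> y * cmod (complex_of_real (h y * indicator B y)) \<partial>M)"
      using h_nonneg by (intro Bochner_Integration.integral_cong) (auto simp: norm_mult abs_mult)
    finally show ?thesis .
  qed
  define S where "S B x = F (A (\<lambda>y. complex_of_real (h y * indicator B y)) x)" for B x
  obtain k where k: "k \<in> borel_measurable (P \<Otimes>\<^sub>M Q)" "\<And>z. \<bar>k z\<bar> \<le> 1"
    "\<And>B. B \<in> sets Q \<Longrightarrow> AE x in P. S B x = (\<integral>y. k (x, y) * indicator B y \<partial>Q)"
  proof (rule dominated_AE_additive_kernel[OF fP fQ, of S])
    fix B assume "B \<in> sets Q"
    then have B: "B \<in> sets M" by simp
    have [measurable]: "A (\<lambda>y. complex_of_real (h y * indicator B y)) \<in> borel_measurable M"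
      using hB[OF B] by (intro A_meas) auto
    show "S B \<in> borel_measurable P"
      unfolding S_def by measurable
    have "AE x in M. \<bar>S B x\<bar> \<le> measure Q B"
      using A_bound[OF conjunct1[OF hB[OF B]] conjunct2[OF hB[OF B]]] unfolding mQ[OF B] S_def
      by eventually_elim (rule order_trans[OF F(3)])
    then show "AE x in P. \<bar>S B x\<bar> \<le> measure Q B" by (rule AE_P)
  next
    fix B C assume "B \<in> sets Q" "C \<in> sets Q" and disj: "B \<inter> C = {}"
    then have B: "B \<in> sets M" and C: "C \<in> sets M" by auto
    have "AE x in M. A (\<lambda>y. complex_of_real (h y * indicator B y) + complex_of_real (h y * indicator C y)) x
      = A (\<lambda>y. complex_of_real (h y * indicator B y)) x + A (\<lambda>y. complex_of_real (h y * indicator C y)) x"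
      using hB[OF B] hB[OF C] by (intro A_add) auto
    moreover have "(\<lambda>y. complex_of_real (h y * indicator B y) + complex_of_real (h y * indicator C y))
       = (\<lambda>y. complex_of_real (h y * indicator (B \<union> C) y))"
      using disj by (auto simp: fun_eq_iff split: split_indicator)
    ultimately have "AE x in M. S (B \<union> C) x = S B x + S C x"
      unfolding S_def by (auto simp: F(2))
    then show "AE x in P. S (B \<union> C) x = S B x + S C x" by (rule AE_P)
  qed blast
  have k_meas [measurable]: "k \<in> borel_measurable (M \<Otimes>\<^sub>M M)"
    using k(1) measurable_cong_sets[OF sets_pair_measure_cong[OF sets] refl] by blast
  show ?thesis
  proof (rule that[OF k_meas k(2)])
    fix B assume B [measurable]: "B \<in> sets M"
    then have "AE x in M. S B x = (\<integral>y. k (x, y) * indicator B y \<partial>Q)"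
      by (intro AE_M k(3)) auto
    with AE_space show "AE x in M. F (A (\<lambda>y. complex_of_real (h y * indicator B y)) x)
       = (\<integral>y. k (x, y) * \<phi> y * (h y * indicator B y) \<partial>M)"
    proof eventually_elim
      case (elim x)
      have [measurable]: "(\<lambda>y. k (x, y)) \<in> borel_measurable M"
        using elim(1) by measurable
      have "S B x = (\<integral>y. \<phi> y * h y * (k (x, y) * indicator B y) \<partial>M)"
        unfolding elim(2) Q_def using h_nonneg \<phi>_nonneg by (subst integral_real_density) auto
      then show ?case by (simp add: S_def mult_ac)
    qed
  qed
qed

text \<open>A kernel valid for \<open>h\<close> times indicators extends by linearity to
  \<open>h\<close> times simple functions, and from there to L^1 \<inter> L^2 by approximation in
  the \<phi>-weighted L^1 seminorm. The factor 2 comes from adding the bounds for the real and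
  imaginary parts.\<close>

lemma kernel_exists:
  obtains k where "(\<lambda>z. k (fst z) (snd z)) \<in> borel_measurable (M \<Otimes>\<^sub>M M)"
    "\<And>x y. cmod (k x y) \<le> 2 * \<phi> y"
    "\<And>f. integrable M f \<Longrightarrow> memLp M 2 f \<Longrightarrow>
       AE x in M. integrable M (\<lambda>y. k x y * f y) \<and> A f x = (\<integral>y. k x y * f y \<partial>M)"
proof -
  obtain h :: "'a \<Rightarrow> real" where h [measurable]: "h \<in> borel_measurable M" and h01: "\<And>x. 0 \<le> h x" "\<And>x. h x \<le> 1"
    and h_pos: "\<And>x. x \<in> space M \<Longrightarrow> 0 < h x" and h_int: "integrable M h"
    using positive_integrable_weight by blast
  have hg: "integrable M (\<lambda>y. h y * g y) \<and> memLp M 2 (\<lambda>y. h y * g y)"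
    if [measurable]: "g \<in> borel_measurable M" and g: "\<And>x. x \<in> space M \<Longrightarrow> cmod (g x) \<le> U" for g :: "'a \<Rightarrow> complex" and U
  proof
    show "integrable M (\<lambda>y. h y * g y)"
    proof (rule Bochner_Integration.integrable_bound)
      show "integrable M (\<lambda>y. U * h y)" using h_int by simp
      show "AE y in M. norm (h y * g y) \<le> norm (U * h y)"
      proof (rule AE_I2)
        fix y assume "y \<in> space M"
        then have "cmod (g y) \<le> \<bar>U\<bar>" using g[of y] by simp
        then show "norm (h y * g y) \<le> norm (U * h y)"
          using h01[of y] mult_left_mono[of "cmod (g y)" "\<bar>U\<bar>" "h y"]
          by (simp add: norm_mult abs_mult) (simp add: mult.commute)
      qed
    qed measurable
    show "memLp M 2 (\<lambda>y. h y * g y)"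
      unfolding memLp_2_iff
    proof
      show "integrable M (\<lambda>y. (cmod (h y * g y))\<^sup>2)"
      proof (rule Bochner_Integration.integrable_bound)
        show "integrable M (\<lambda>y. U\<^sup>2 * h y)" using h_int by simp
        show "AE y in M. norm ((cmod (h y * g y))\<^sup>2) \<le> norm (U\<^sup>2 * h y)"
        proof (rule AE_I2)
          fix y assume "y \<in> space M"
          then have "(cmod (g y))\<^sup>2 \<le> U\<^sup>2" using g[of y] by (intro power_mono) auto
          moreover have "(h y)\<^sup>2 \<le> h y"
            using h01[of y] by (simp add: power2_eq_square mult_left_le_one_le)
          ultimately have "(h y)\<^sup>2 * (cmod (g y))\<^sup>2 \<le> h y * U\<^sup>2"
            using h01 by (intro mult_mono) auto
          then show "norm ((cmod (h y * g y))\<^sup>2) \<le> norm (U\<^sup>2 * h y)"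
            using h01[of y] by (simp add: norm_mult power_mult_distrib abs_mult mult_ac)
        qed
      qed measurable
    qed measurable
  qed
  have hB: "integrable M (\<lambda>y. complex_of_real (h y * indicator B y)) \<and>
      memLp M 2 (\<lambda>y. complex_of_real (h y * indicator B y))" if [measurable]: "B \<in> sets M" for B
    using hg[of "\<lambda>y. complex_of_real (indicator B y)" 1] by (simp add: indicator_def)
  obtain k1 where k1 [measurable]: "k1 \<in> borel_measurable (M \<Otimes>\<^sub>M M)" and k1_le: "\<And>z. \<bar>k1 z\<bar> \<le> 1"
    and k1_B: "\<And>B. B \<in> sets M \<Longrightarrow> AE x in M. Re (A (\<lambda>y. complex_of_real (h y * indicator B y)) x)
       = (\<integral>y. k1 (x, y) * \<phi> y * (h y * indicator B y) \<partial>M)"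
    by (rule kernel_on_indicators[OF h h01(1) h_pos h_int hB, of Re]) (auto simp: abs_Re_le_cmod)
  obtain k2 where k2 [measurable]: "k2 \<in> borel_measurable (M \<Otimes>\<^sub>M M)" and k2_le: "\<And>z. \<bar>k2 z\<bar> \<le> 1"
    and k2_B: "\<And>B. B \<in> sets M \<Longrightarrow> AE x in M. Im (A (\<lambda>y. complex_of_real (h y * indicator B y)) x)
       = (\<integral>y. k2 (x, y) * \<phi> y * (h y * indicator B y) \<partial>M)"
    by (rule kernel_on_indicators[OF h h01(1) h_pos h_int hB, of Im]) (auto simp: abs_Im_le_cmod)
  define k where "k x y = Complex (k1 (x, y)) (k2 (x, y)) * complex_of_real (\<phi> y)" for x y
  have k_meas: "(\<lambda>z. k (fst z) (snd z)) \<in> borel_measurable (M \<Otimes>\<^sub>M M)"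
    unfolding k_def Complex_eq by measurable
  have k_le: "cmod (k x y) \<le> 2 * \<phi> y" for x y
  proof -
    have "cmod (Complex (k1 (x, y)) (k2 (x, y))) \<le> 2"
      using cmod_le[of "Complex (k1 (x, y)) (k2 (x, y))"] k1_le[of "(x, y)"] k2_le[of "(x, y)"] by simp
    then show ?thesis
      using \<phi>_nonneg[of y] by (simp add: k_def norm_mult mult_right_mono)
  qed
  have kx [measurable]: "(\<lambda>y. k x y) \<in> borel_measurable M" if [measurable]: "x \<in> space M" for x
    unfolding k_def Complex_eq by measurable
  have k_int: "integrable M (\<lambda>y. k x y * f y)" if "x \<in> space M" "integrable M f" for x f
  proof (rule Bochner_Integration.integrable_bound)
    have [measurable]: "f \<in> borel_measurable M" using that by auto
    note kx[OF that(1), measurable]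
    show "(\<lambda>y. k x y * f y) \<in> borel_measurable M" by measurable
    show "integrable M (\<lambda>y. 2 * (\<phi> y * cmod (f y)))"
      using integrable_\<phi>_mult[OF that(2)] by simp
    show "AE y in M. norm (k x y * f y) \<le> norm (2 * (\<phi> y * cmod (f y)))"
      using k_le \<phi>_nonneg by (auto simp: norm_mult abs_mult mult.assoc[symmetric] intro!: mult_right_mono)
  qed
  \<comment> \<open>The functions on which \<open>k\<close> represents \<open>A\<close>: a linear
    class, shown to be closed within L^1 \<inter> L^2 under convergence in the \<phi>-weighted L^1
    seminorm.\<close>
  define D where "D f \<longleftrightarrow> integrable M f \<and> memLp M 2 f \<and> (AE x in M. A f x = (\<integral>y. k x y * f y \<partial>M))" for f
  have D_B: "D (\<lambda>y. complex_of_real (h y * indicator B y))" if B: "B \<in> sets M" for B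
    unfolding D_def
  proof (intro conjI)
    let ?f = "\<lambda>y. complex_of_real (h y * indicator B y)"
    show "AE x in M. A ?f x = (\<integral>y. k x y * ?f y \<partial>M)"
      using AE_space k1_B[OF B] k2_B[OF B]
    proof eventually_elim
      case (elim x)
      have i: "integrable M (\<lambda>y. k x y * ?f y)"
        using hB[OF B] by (intro k_int elim) auto
      have "Re (\<integral>y. k x y * ?f y \<partial>M) = (\<integral>y. Re (k x y * ?f y) \<partial>M)"
        by (rule integral_Re[OF i, symmetric])
      also have "\<dots> = (\<integral>y. k1 (x, y) * \<phi> y * (h y * indicator B y) \<partial>M)"
        by (intro Bochner_Integration.integral_cong) (auto simp: k_def)
      finally have re: "Re (\<integral>y. k x y * ?f y \<partial>M) = Re (A ?f x)"
        using elim by simp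
      have "Im (\<integral>y. k x y * ?f y \<partial>M) = (\<integral>y. Im (k x y * ?f y) \<partial>M)"
        by (rule integral_Im[OF i, symmetric])
      also have "\<dots> = (\<integral>y. k2 (x, y) * \<phi> y * (h y * indicator B y) \<partial>M)"
        by (intro Bochner_Integration.integral_cong) (auto simp: k_def)
      finally have im: "Im (\<integral>y. k x y * ?f y \<partial>M) = Im (A ?f x)"
        using elim by simp
      show ?case using re im by (simp add: complex_eq_iff)
    qed
  qed (use hB[OF B] in auto)
  have D_scale: "D (\<lambda>y. a * f y)" if "D f" for a f
    unfolding D_def
  proof (intro conjI)
    have "AE x in M. A (\<lambda>y. a * f y) x = a * A f x"
      using that by (intro A_scale) (auto simp: D_def)
    moreover have "AE x in M. A f x = (\<integral>y. k x y * f y \<partial>M)"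
      using that by (auto simp: D_def)
    ultimately show "AE x in M. A (\<lambda>y. a * f y) x = (\<integral>y. k x y * (a * f y) \<partial>M)"
    proof eventually_elim
      case (elim x)
      have "(\<integral>y. k x y * (a * f y) \<partial>M) = (\<integral>y. a * (k x y * f y) \<partial>M)"
        by (simp add: mult_ac)
      then show ?case using elim by simp
    qed
  qed (use that in \<open>auto simp: D_def intro: memLp_2_cmult\<close>)
  have D_add: "D (\<lambda>y. f y + g y)" if "D f" "D g" for f g
    unfolding D_def
  proof (intro conjI)
    have "AE x in M. A (\<lambda>y. f y + g y) x = A f x + A g x"
      using that by (intro A_add) (auto simp: D_def)
    moreover have "AE x in M. A f x = (\<integral>y. k x y * f y \<partial>M)" "AE x in M. A g x = (\<integral>y. k x y * g y \<partial>M)"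
      using that by (auto simp: D_def)
    ultimately show "AE x in M. A (\<lambda>y. f y + g y) x = (\<integral>y. k x y * (f y + g y) \<partial>M)"
      using AE_space
    proof eventually_elim
      case (elim x)
      have "integrable M (\<lambda>y. k x y * f y)" "integrable M (\<lambda>y. k x y * g y)"
        using that elim(4) by (auto intro!: k_int simp: D_def)
      then show ?case using elim by (simp add: distrib_left)
    qed
  qed (use that in \<open>auto simp: D_def intro: memLp_2_add\<close>)
  have D_lim: "D f" if f: "integrable M f" "memLp M 2 f" and fi: "\<And>i. D (F i)"
      and conv: "(\<lambda>i. \<integral>y. \<phi> y * cmod (f y - F i y) \<partial>M) \<longlonglongrightarrow> 0" for f F
    unfolding D_def
  proof (intro conjI f)
    define e where "e i = (\<integral>y. \<phi> y * cmod (f y - F i y) \<partial>M)" for i :: nat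
    have "AE x in M. \<forall>i. cmod (A f x - A (F i) x) \<le> e i"
      unfolding e_def using fi f by (subst AE_all_countable) (auto intro!: A_diff_bound simp: D_def)
    moreover have "AE x in M. \<forall>i. A (F i) x = (\<integral>y. k x y * F i y \<partial>M)"
      using fi by (subst AE_all_countable) (auto simp: D_def)
    ultimately show "AE x in M. A f x = (\<integral>y. k x y * f y \<partial>M)"
      using AE_space
    proof eventually_elim
      case (elim x)
      \<comment> \<open>One \<open>e i\<close> comes from the bound on \<open>A\<close>, two more
        from the bound \<open>2 * \<phi> y\<close> on the kernel.\<close>
      have "cmod (A f x - (\<integral>y. k x y * f y \<partial>M)) \<le> 3 * e i" for i
      proof -
        have Fi: "integrable M (F i)" using fi by (auto simp: D_def)
        have i: "integrable M (\<lambda>y. k x y * f y)" "integrable M (\<lambda>y. k x y * F i y)"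
          using f Fi elim(3) by (auto intro!: k_int)
        have "cmod ((\<integral>y. k x y * F i y \<partial>M) - (\<integral>y. k x y * f y \<partial>M)) = cmod (\<integral>y. k x y * (F i y - f y) \<partial>M)"
          using i by (simp add: right_diff_distrib)
        also have "\<dots> \<le> (\<integral>y. 2 * (\<phi> y * cmod (f y - F i y)) \<partial>M)"
        proof (rule order_trans[OF integral_norm_bound integral_mono])
          show "integrable M (\<lambda>y. cmod (k x y * (F i y - f y)))"
            using f Fi elim(3) by (intro integrable_norm k_int) auto
          show "integrable M (\<lambda>y. 2 * (\<phi> y * cmod (f y - F i y)))"
            using f Fi integrable_\<phi>_mult[of "\<lambda>y. f y - F i y"] by auto
          show "norm (k x y * (F i y - f y)) \<le> 2 * (\<phi> y * cmod (f y - F i y))" for y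
            using mult_right_mono[OF k_le[of x y], of "cmod (f y - F i y)"]
            by (simp add: norm_mult norm_minus_commute mult.assoc)
        qed
        also have "\<dots> = 2 * e i" by (simp add: e_def)
        finally have "cmod ((\<integral>y. k x y * F i y \<partial>M) - (\<integral>y. k x y * f y \<partial>M)) \<le> 2 * e i" .
        moreover have "cmod (A f x - (\<integral>y. k x y * F i y \<partial>M)) \<le> e i"
          using elim(1,2) by metis
        ultimately show ?thesis
          using norm_triangle_ineq[of "A f x - (\<integral>y. k x y * F i y \<partial>M)" "(\<integral>y. k x y * F i y \<partial>M) - (\<integral>y. k x y * f y \<partial>M)"]
          by simp
      qed
      moreover have "(\<lambda>i. 3 * e i) \<longlonglongrightarrow> 3 * 0"
        using conv unfolding e_def by (intro tendsto_intros)
      ultimately have "cmod (A f x - (\<integral>y. k x y * f y \<partial>M)) \<le> 3 * 0"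
        by (intro LIMSEQ_le_const[of "\<lambda>i. 3 * e i"]) blast+
      then show ?case by simp
    qed
  qed
  \<comment> \<open>Obtained as the limit of the constant sequence \<open>f\<close>, since the
    seminorm ignores points outside \<open>space M\<close>.\<close>
  have D_cong: "D g" if "D f" "g \<in> borel_measurable M" "\<And>y. y \<in> space M \<Longrightarrow> g y = f y" for f g
  proof (rule D_lim[of _ "\<lambda>_. f"])
    show "integrable M g"
      using that Bochner_Integration.integrable_cong[OF refl, of M g f] by (auto simp: D_def)
    show "memLp M 2 g"
    proof (rule memLp_2_bounded)
      show "memLp M 2 f" using that(1) by (simp add: D_def)
      show "AE y in M. cmod (g y) \<le> cmod (f y)" using that(3) by (intro AE_I2) simp
    qed fact
    have "(\<integral>y. \<phi> y * cmod (g y - f y) \<partial>M) = (\<integral>y. 0 \<partial>M)"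
      using that(3) by (intro Bochner_Integration.integral_cong) auto
    then show "(\<lambda>i::nat. \<integral>y. \<phi> y * cmod (g y - f y) \<partial>M) \<longlonglongrightarrow> 0" by simp
  qed fact
  have D_sum: "D (\<lambda>y. \<Sum>v\<in>V. F v y)" if "finite V" "\<And>v. v \<in> V \<Longrightarrow> D (F v)" for V :: "complex set" and F
    using that
  proof (induction V)
    case empty
    then show ?case using D_B[of "{}"] by simp
  next
    case (insert v V)
    then show ?case by (auto intro: D_add)
  qed
  have D_simple: "D (\<lambda>y. h y * g y)" if g: "simple_function M g" for g :: "'a \<Rightarrow> complex"
  proof -
    have [measurable]: "g \<in> borel_measurable M" using g by (rule borel_measurable_simple_function)
    show ?thesis
    proof (rule D_cong)
      show "D (\<lambda>y. \<Sum>v\<in>g ` space M. v * complex_of_real (h y * indicator (g -` {v} \<inter> space M) y))"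
        using simple_functionD[OF g] by (intro D_sum D_scale D_B) auto
      fix y assume "y \<in> space M"
      from simple_function_indicator_representation_banach[OF g this]
      have "h y * g y = h y * (\<Sum>v\<in>g ` space M. indicator (g -` {v} \<inter> space M) y *\<^sub>R v)"
        by (rule arg_cong)
      then show "h y * g y = (\<Sum>v\<in>g ` space M. v * complex_of_real (h y * indicator (g -` {v} \<inter> space M) y))"
        by (simp add: sum_distrib_left scaleR_conv_of_real mult_ac)
    qed measurable
  qed
  have "D f" if f: "integrable M f" "memLp M 2 f" for f
  proof -
    have f_meas [measurable]: "f \<in> borel_measurable M" using f by auto
    \<comment> \<open>Approximating \<open>f / h\<close> instead of \<open>f\<close> makes the
      approximants \<open>h\<close> times simple functions. They are at most
      \<open>2 * cmod (f y)\<close> in modulus, whence the factor 3 in the dominating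
      function.\<close>
    have "(\<lambda>y. f y / h y) \<in> borel_measurable M" by measurable
    from borel_measurable_implies_sequence_metric[OF this, of 0]
    obtain G where G: "\<And>i. simple_function M (G i)" "\<And>y. y \<in> space M \<Longrightarrow> (\<lambda>i. G i y) \<longlonglongrightarrow> f y / h y"
      "\<And>i y. y \<in> space M \<Longrightarrow> cmod (G i y) \<le> 2 * cmod (f y / h y)"
      by (simp only: dist_0_norm dist_norm diff_0_right) blast
    have [measurable]: "G i \<in> borel_measurable M" for i
      using G(1) by (rule borel_measurable_simple_function)
    show ?thesis
    proof (rule D_lim[OF f, of "\<lambda>i y. h y * G i y"])
      show "D (\<lambda>y. h y * G i y)" for i using G(1) by (rule D_simple)
      have "(\<lambda>i. \<integral>y. \<phi> y * cmod (f y - h y * G i y) \<partial>M) \<longlonglongrightarrow> (\<integral>y. 0 \<partial>M)"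
      proof (rule integral_dominated_convergence[where w="\<lambda>y. 3 * (\<phi> y * cmod (f y))"])
        show "integrable M (\<lambda>y. 3 * (\<phi> y * cmod (f y)))"
          using integrable_\<phi>_mult[OF f(1)] by simp
        show "AE y in M. (\<lambda>i. \<phi> y * cmod (f y - h y * G i y)) \<longlonglongrightarrow> 0"
        proof (rule AE_I2)
          fix y assume y: "y \<in> space M"
          have "(\<lambda>i. \<phi> y * cmod (f y - h y * G i y)) \<longlonglongrightarrow> \<phi> y * cmod (f y - h y * (f y / h y))"
            by (intro tendsto_intros G(2) y)
          then show "(\<lambda>i. \<phi> y * cmod (f y - h y * G i y)) \<longlonglongrightarrow> 0"
            using h_pos[OF y] by simp
        qed
        show "AE y in M. norm (\<phi> y * cmod (f y - h y * G i y)) \<le> 3 * (\<phi> y * cmod (f y))" for i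
        proof (rule AE_I2)
          fix y assume y: "y \<in> space M"
          have "cmod (h y * G i y) \<le> h y * (2 * cmod (f y / h y))"
            using G(3)[OF y, of i] h01[of y] by (simp add: norm_mult mult_left_mono)
          also have "\<dots> = 2 * cmod (f y)"
            using h_pos[OF y] by (simp add: norm_divide)
          finally have "cmod (f y - h y * G i y) \<le> 3 * cmod (f y)"
            using norm_triangle_ineq4[of "f y" "h y * G i y"] by simp
          then have "\<phi> y * cmod (f y - h y * G i y) \<le> \<phi> y * (3 * cmod (f y))"
            using \<phi>_nonneg by (intro mult_left_mono) auto
          then show "norm (\<phi> y * cmod (f y - h y * G i y)) \<le> 3 * (\<phi> y * cmod (f y))"
            using \<phi>_nonneg[of y] by (simp add: abs_mult)
        qed
      qed measurable
      then show "(\<lambda>i. \<integral>y. \<phi> y * cmod (f y - h y * G i y) \<partial>M) \<longlonglongrightarrow> 0" by simp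
    qed
  qed
  then have "AE x in M. integrable M (\<lambda>y. k x y * f y) \<and> A f x = (\<integral>y. k x y * f y \<partial>M)"
    if "integrable M f" "memLp M 2 f" for f
    using AE_space[of M] that k_int by (fastforce simp: D_def)
  then show ?thesis
    using that k_meas k_le by blast
qed

end

section \<open>The kernel bound\<close>

text \<open>Chebyshev's inequality with exponent \<open>2 / (1 - \<theta>)\<close>, written as a
  square to fit \<open>l2norm_weighted_bound\<close>. Positivity on \<open>\<Omega>\<close> has to
  be assumed because \<open>0 powr (- \<theta>)\<close> is 0, so that the norm does not see zeros of
  \<open>\<psi>\<close>.\<close>

lemma sublevel_measure_bound:
  fixes \<psi> :: "'a \<Rightarrow> real" and \<theta> a :: real
  assumes \<theta>: "0 < \<theta>" "\<theta> < 1" and \<Omega> [measurable]: "\<Omega> \<in> sets M" and a: "0 \<le> a" and l: "0 < l"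
    and pos: "AE x in M. x \<in> \<Omega> \<longrightarrow> 0 < \<psi> x"
    and meas: "{x\<in>\<Omega>. \<psi> x < l} \<in> sets M"
    and norm: "Lnorm M (2 / (1 - \<theta>)) (\<lambda>x. indicator \<Omega> x * \<psi> x powr (- \<theta>)) \<le> ennreal a"
  shows "emeasure M {x\<in>\<Omega>. \<psi> x < l} \<le> ennreal ((a powr (1 / (1 - \<theta>)) * l powr (\<theta> / (1 - \<theta>)))\<^sup>2)"
proof -
  define q where "q = 2 / (1 - \<theta>)"
  have q: "0 < q" using \<theta> by (simp add: q_def)
  define g where "g x = indicator \<Omega> x * \<psi> x powr (- \<theta>)" for x
  have g: "memLp M q g"
    using norm unfolding q_def g_def by (rule memLp_if_Lnorm_le)
  define I where "I = (\<integral>x. norm (g x) powr q \<partial>M)"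
  have I0: "0 \<le> I" by (simp add: I_def)
  have "I powr (1 / q) \<le> a"
    using norm g a unfolding g_def[symmetric] q_def[symmetric]
    by (auto simp: Lnorm_def memLp_def I_def)
  then have "(I powr (1 / q)) powr q \<le> a powr q"
    using q by (intro powr_mono2) auto
  then have I: "I \<le> a powr q"
    using q I0 by (simp add: powr_powr)
  have "emeasure M {x\<in>\<Omega>. \<psi> x < l} = (\<integral>\<^sup>+x. indicator {x\<in>\<Omega>. \<psi> x < l} x \<partial>M)"
    using meas by simp
  also have "\<dots> \<le> (\<integral>\<^sup>+x. ennreal (l powr (\<theta> * q)) * ennreal (norm (g x) powr q) \<partial>M)"
  proof (rule nn_integral_mono_AE)
    show "AE x in M. indicator {x\<in>\<Omega>. \<psi> x < l} x \<le> ennreal (l powr (\<theta> * q)) * ennreal (norm (g x) powr q)"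
      using pos
    proof eventually_elim
      case (elim x)
      show ?case
      proof (cases "x \<in> \<Omega> \<and> \<psi> x < l")
        case True
        then have \<psi>: "0 < \<psi> x" using elim by simp
        have "1 = l powr (\<theta> * q) * l powr (- \<theta> * q)"
          using l by (simp add: powr_add[symmetric])
        also have "\<dots> \<le> l powr (\<theta> * q) * \<psi> x powr (- \<theta> * q)"
          using True \<psi> \<theta> q by (intro mult_left_mono powr_mono2') (auto simp: mult_nonneg_nonneg)
        also have "\<psi> x powr (- \<theta> * q) = norm (g x) powr q"
          using True by (simp add: g_def powr_powr)
        finally have "ennreal 1 \<le> ennreal (l powr (\<theta> * q) * norm (g x) powr q)"
          by (rule ennreal_leI)
        then show ?thesis using True by (simp add: ennreal_mult)
      next
        case False
        then show ?thesis by (auto simp: indicator_def)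
      qed
    qed
  qed
  also have "\<dots> = ennreal (l powr (\<theta> * q)) * ennreal I"
  proof -
    have "(\<integral>\<^sup>+x. ennreal (norm (g x) powr q) \<partial>M) = ennreal I"
      unfolding I_def using g by (intro nn_integral_eq_integral) (auto simp: memLp_def)
    moreover have "(\<lambda>x. ennreal (norm (g x) powr q)) \<in> borel_measurable M"
    proof -
      have [measurable]: "g \<in> borel_measurable M" using g by (simp add: memLp_def)
      show ?thesis by measurable
    qed
    ultimately show ?thesis by (simp add: nn_integral_cmult)
  qed
  also have "\<dots> = ennreal (l powr (\<theta> * q) * I)"
    using I0 by (simp add: ennreal_mult)
  also have "\<dots> \<le> ennreal (l powr (\<theta> * q) * a powr q)"
    using I by (intro ennreal_leI mult_left_mono) auto
  also have "l powr (\<theta> * q) * a powr q = (a powr (1 / (1 - \<theta>)) * l powr (\<theta> / (1 - \<theta>)))\<^sup>2"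
    unfolding power2_eq_square using powr_add[of a "1 / (1 - \<theta>)" "1 / (1 - \<theta>)"]
      powr_add[of l "\<theta> / (1 - \<theta>)" "\<theta> / (1 - \<theta>)"]
    by (simp add: q_def mult_ac)
  finally show ?thesis .
qed

lemma powr_neg_le_imp_ge:
  fixes x \<theta> b :: real
  assumes "0 < x" "0 < \<theta>" "0 < b" "x powr (- \<theta>) \<le> b"
  shows "b powr (- 1 / \<theta>) \<le> x"
proof -
  have "b powr (- 1 / \<theta>) \<le> (x powr (- \<theta>)) powr (- 1 / \<theta>)"
    using assms by (intro powr_mono2') auto
  also have "\<dots> = x"
    using assms by (simp add: powr_powr)
  finally show ?thesis .
qed

theorem theorem1:
  fixes M :: "'a::topological_space measure"
    and T :: "real \<Rightarrow> ('a \<Rightarrow> complex) \<Rightarrow> ('a \<Rightarrow> complex)"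
    and \<psi> :: "real \<Rightarrow> 'a \<Rightarrow> real"
    and \<Omega> :: "real \<Rightarrow> 'a set"
    and Mc cS j c \<theta> c1 c2 c3 :: real
  assumes lc: "locally_compact_space (euclidean :: 'a topology)"
    and borel: "sets M = sets borel"
    and sf: "sigma_finite_measure M"
    and sg: "contraction_C0_semigroup M T"
    and hc: "Mc \<ge> 1" "cS > 0" "j > 1" "c \<ge> 0"
    and B11: "\<And>t f. t \<ge> 0 \<Longrightarrow> memLp M 1 f \<Longrightarrow> memLp M 2 f \<Longrightarrow>
                Lnorm M 1 (T t f) \<le> ennreal Mc * Lnorm M 1 f"
    and B12: "\<And>u w. neg_generator M T u w \<Longrightarrow>
                ennreal cS * (Lnorm M (2 * j) u)\<^sup>2 \<le> ennreal (- Re (\<integral>x. w x * cnj (u x) \<partial>M))"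
    and B13: "\<And>t f. t > 0 \<Longrightarrow> memLp M 2 f \<Longrightarrow>
                Linf_norm M (T t f) \<le> ennreal (c * t powr (- (j / (j - 1)) / 2)) * Lnorm M 2 f"
    and B21: "\<And>s. s > 0 \<Longrightarrow> \<exists>N. closed N \<and> N \<in> sets M \<and> emeasure M N = 0 \<and>
                (\<forall>x. 0 \<le> \<psi> s x) \<and>
                (AE x in M. x \<notin> N \<longrightarrow> \<psi> s x \<noteq> 0) \<and>
                locally_integrable_on M (- N) (\<psi> s) \<and>
                locally_integrable_on M (- N) (\<lambda>x. inverse (\<psi> s x))"
    and theta: "0 < \<theta>" "\<theta> < 1"
    and hc2: "c1 \<ge> 0" "c2 \<ge> 0" "c3 \<ge> 0"
    and Omega: "\<And>s. s > 0 \<Longrightarrow> \<Omega> s \<in> sets M"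
    and B22: "\<And>s x. s > 0 \<Longrightarrow> x \<notin> \<Omega> s \<Longrightarrow> \<psi> s x > 0 \<and> \<psi> s x powr (- \<theta>) \<le> c2"
    and B23: "\<And>s. s > 0 \<Longrightarrow> (AE x in M. x \<in> \<Omega> s \<longrightarrow> \<psi> s x > 0) \<and>
                Lnorm M (2 / (1 - \<theta>)) (\<lambda>x. indicator (\<Omega> s) x * \<psi> s x powr (- \<theta>))
                  \<le> ennreal (c3 * s powr ((j / (j - 1)) / (2 / (1 - \<theta>))))"
    and B3: "\<And>s t f. s > 0 \<Longrightarrow> s / 2 \<le> t \<Longrightarrow> t \<le> s \<Longrightarrow>
                memLp M 1 (\<lambda>x. complex_of_real (inverse (\<psi> s x)) * f x) \<Longrightarrow>
                memLp M 2 (\<lambda>x. complex_of_real (inverse (\<psi> s x)) * f x) \<Longrightarrow>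
                Lnorm M 1 (\<lambda>x. complex_of_real (\<psi> s x) *
                   T t (\<lambda>y. complex_of_real (inverse (\<psi> s y)) * f y) x)
                  \<le> ennreal c1 * Lnorm M 1 f"
  shows "\<exists>C. \<forall>t>0. \<exists>k :: 'a \<Rightarrow> 'a \<Rightarrow> complex.
           (\<lambda>z. k (fst z) (snd z)) \<in> borel_measurable (M \<Otimes>\<^sub>M M) \<and>
           (\<forall>f. memLp M 1 f \<and> memLp M 2 f \<longrightarrow>
              (AE x in M. integrable M (\<lambda>y. k x y * f y) \<and>
                          T t f x = (\<integral>y. k x y * f y \<partial>M))) \<and>
           (AE z in M \<Otimes>\<^sub>M M. cmod (k (fst z) (snd z)) \<le> C * t powr (- (j / (j - 1))) * \<psi> t (snd z))"
proof -
  define \<alpha> where "\<alpha> = j / (j - 1) / 2"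
  have \<alpha>: "0 \<le> \<alpha>" using hc by (simp add: \<alpha>_def)
  have \<alpha>2: "- 2 * \<alpha> = - (j / (j - 1))"
    unfolding \<alpha>_def using hc by (simp add: field_simps)
  have \<alpha>1: "- (j / (j - 1)) / 2 = - \<alpha>"
    unfolding \<alpha>_def by simp
  have space: "space M = UNIV"
    using sets_eq_imp_space_eq[OF borel] by simp
  interpret sigma_finite_measure M by fact
  note sup = B13[unfolded \<alpha>1]
  define \<gamma> where "\<gamma> = \<theta> / (1 - \<theta>)"
  \<comment> \<open>By (B22) the weight is at least \<open>l\<^sub>0\<close> off
    \<open>\<Omega> s\<close>, so sublevel sets for \<open>l \<le> l\<^sub>0\<close> lie inside
    \<open>\<Omega> s\<close>. Adding 1 to \<open>c2\<close> keeps the base positive.\<close>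
  define l\<^sub>0 where "l\<^sub>0 = (c2 + 1) powr (- 1 / \<theta>)"
  define m where "m = c3 powr (1 / (1 - \<theta>))"
  have \<gamma>: "0 < \<gamma>" and l0: "0 < l\<^sub>0" and m: "0 \<le> m"
    using theta hc2 by (auto simp: \<gamma>_def l\<^sub>0_def m_def)
  have \<psi>_nonneg: "0 \<le> \<psi> s x" if "0 < s" for s x
    using B21[OF that] by auto
  have \<psi>_ge: "l\<^sub>0 \<le> \<psi> s x" if "0 < s" "x \<notin> \<Omega> s" for s x
    unfolding l\<^sub>0_def using B22[OF that] theta hc2 by (intro powr_neg_le_imp_ge) auto
  \<comment> \<open>Outside \<open>\<Omega> s\<close> the weight need not be measurable: local integrability says nothing globally unless \<open>X\<close> is \<open>\<sigma>\<close>-compact.\<close>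
  have \<psi>\<Omega>: "(\<lambda>x. indicator (\<Omega> s) x * \<psi> s x) \<in> borel_measurable M" if "0 < s" for s
  proof -
    have "(\<lambda>x. indicator (\<Omega> s) x * \<psi> s x powr (- \<theta>)) \<in> borel_measurable M"
      using memLp_if_Lnorm_le[OF conjunct2[OF B23[OF that]]] by (simp add: memLp_def)
    \<comment> \<open>The inverse power recovers the weight on \<open>\<Omega> s\<close>. At its
      zeros, and off \<open>\<Omega> s\<close>, both sides are 0 because powers of 0 are 0.\<close>
    then have "(\<lambda>x. (indicator (\<Omega> s) x * \<psi> s x powr (- \<theta>)) powr (- 1 / \<theta>)) \<in> borel_measurable M"
      by measurable
    also have "(\<lambda>x. (indicator (\<Omega> s) x * \<psi> s x powr (- \<theta>)) powr (- 1 / \<theta>)) = (\<lambda>x. indicator (\<Omega> s) x * \<psi> s x)"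
      using theta \<psi>_nonneg[OF that] by (auto simp: fun_eq_iff powr_powr indicator_def)
    finally show ?thesis .
  qed
  have sub_meas: "{x\<in>\<Omega> s. \<psi> s x < l} \<in> sets M" "{x\<in>\<Omega> s. 0 < \<psi> s x \<and> \<psi> s x < l} \<in> sets M"
    if "0 < s" for s l
  proof -
    note [measurable] = \<psi>\<Omega>[OF that] Omega[OF that]
    have "{x\<in>\<Omega> s. \<psi> s x < l} = {x\<in>space M. x \<in> \<Omega> s \<and> indicator (\<Omega> s) x * \<psi> s x < l}"
      by (auto simp: space)
    also have "\<dots> \<in> sets M" by measurable
    finally show "{x\<in>\<Omega> s. \<psi> s x < l} \<in> sets M" .
    have "{x\<in>\<Omega> s. 0 < \<psi> s x \<and> \<psi> s x < l}
        = {x\<in>space M. x \<in> \<Omega> s \<and> 0 < indicator (\<Omega> s) x * \<psi> s x \<and> indicator (\<Omega> s) x * \<psi> s x < l}"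
      by (auto simp: space)
    also have "\<dots> \<in> sets M" by measurable
    finally show "{x\<in>\<Omega> s. 0 < \<psi> s x \<and> \<psi> s x < l} \<in> sets M" .
  qed
  have sub_measure: "emeasure M {x\<in>\<Omega> s. \<psi> s x < l} \<le> ennreal ((m * l powr \<gamma> * s powr \<alpha>)\<^sup>2)"
    if "0 < s" "0 < l" for s l
  proof -
    \<comment> \<open>Since \<open>1 / (1 - \<theta>)\<close> is \<open>q' / 2\<close>, the exponent
      \<open>j' / q'\<close> of (B23) turns into \<open>j' / 2\<close>, which is
      \<open>\<alpha>\<close>.\<close>
    have "(j / (j - 1)) / (2 / (1 - \<theta>)) * (1 / (1 - \<theta>)) = \<alpha>"
      using theta hc by (simp add: \<alpha>_def)
    then have "(c3 * s powr ((j / (j - 1)) / (2 / (1 - \<theta>)))) powr (1 / (1 - \<theta>)) = m * s powr \<alpha>"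
      using hc2 that by (simp only: powr_mult powr_powr m_def powr_ge_zero)
    then show ?thesis
      using sublevel_measure_bound[OF theta Omega[OF that(1)] _ that(2) conjunct1[OF B23[OF that(1)]]
          sub_meas(1)[OF that(1)] conjunct2[OF B23[OF that(1)]]] hc2
      by (simp add: \<gamma>_def mult_ac)
  qed
  obtain Cw where Cw: "0 \<le> Cw"
    "\<And>s w f N. \<lbrakk>0 < s; memLp M 2 f; \<And>x. 0 \<le> w x; 0 \<le> N;
       \<And>t. s / 2 \<le> t \<Longrightarrow> t \<le> s \<Longrightarrow> integrable M (\<lambda>x. w x * cmod (T t f x)) \<and>
          (\<integral>x. w x * cmod (T t f x) \<partial>M) \<le> N;
       \<And>l. 0 < l \<Longrightarrow> l \<le> l\<^sub>0 \<Longrightarrow> \<exists>E\<in>sets M. (\<forall>x\<in>E. l \<le> w x) \<and>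
          emeasure M (space M - E) \<le> ennreal ((m * l powr \<gamma> * s powr \<alpha>)\<^sup>2)\<rbrakk>
       \<Longrightarrow> AE x in M. cmod (T s f x) \<le> Cw * s powr (- 2 * \<alpha>) * N"
    using weighted_L1_bound_imp_sup_bound[OF sg \<alpha> hc(4) \<gamma> m l0 sup] by blast
  \<comment> \<open>The case of weight 1: no point has weight below \<open>l \<le> 1\<close>, hence
    \<open>m = 0\<close>, and any positive \<open>\<gamma>\<close> serves.\<close>
  obtain Cu where Cu: "0 \<le> Cu"
    "\<And>s w f N. \<lbrakk>0 < s; memLp M 2 f; \<And>x. 0 \<le> w x; 0 \<le> N;
       \<And>t. s / 2 \<le> t \<Longrightarrow> t \<le> s \<Longrightarrow> integrable M (\<lambda>x. w x * cmod (T t f x)) \<and>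
          (\<integral>x. w x * cmod (T t f x) \<partial>M) \<le> N;
       \<And>l. 0 < l \<Longrightarrow> l \<le> 1 \<Longrightarrow> \<exists>E\<in>sets M. (\<forall>x\<in>E. l \<le> w x) \<and>
          emeasure M (space M - E) \<le> ennreal ((0 * l powr 1 * s powr \<alpha>)\<^sup>2)\<rbrakk>
       \<Longrightarrow> AE x in M. cmod (T s f x) \<le> Cu * s powr (- 2 * \<alpha>) * N"
    using weighted_L1_bound_imp_sup_bound[OF sg \<alpha> hc(4) zero_less_one order_refl zero_less_one sup] by blast
  have unweighted: "AE x in M. cmod (T s f x) \<le> Cu * s powr (- 2 * \<alpha>) * (Mc * (\<integral>x. cmod (f x) \<partial>M))"
    if s: "0 < s" and f: "integrable M f" "memLp M 2 f" for s f
  proof (rule Cu(2)[where w="\<lambda>_. 1"])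
    fix t assume "s / 2 \<le> t" "t \<le> s"
    then have t: "0 \<le> t" using s by simp
    have "Lnorm M 1 (T t f) \<le> ennreal Mc * Lnorm M 1 f"
      using f by (intro B11 t) (auto simp: memLp_1_iff)
    then have le: "Lnorm M 1 (T t f) \<le> ennreal (Mc * (\<integral>x. cmod (f x) \<partial>M))"
      using f hc by (simp add: Lnorm_1 ennreal_mult)
    then have i: "integrable M (T t f)"
      using memLp_if_Lnorm_le memLp_1_iff by metis
    show "integrable M (\<lambda>x. 1 * cmod (T t f x)) \<and> (\<integral>x. 1 * cmod (T t f x) \<partial>M) \<le> Mc * (\<integral>x. cmod (f x) \<partial>M)"
      using le i hc by (simp add: Lnorm_1 integral_nonneg_AE)
  next
    fix l :: real assume "0 < l" "l \<le> 1"
    then show "\<exists>E\<in>sets M. (\<forall>x\<in>E. l \<le> 1) \<and> emeasure M (space M - E) \<le> ennreal ((0 * l powr 1 * s powr \<alpha>)\<^sup>2)"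
      by (intro bexI[of _ "space M"]) auto
  qed (use s f hc in \<open>auto intro!: mult_nonneg_nonneg integral_nonneg_AE\<close>)
  \<comment> \<open>The weighted estimate is reserved for this set: \<open>\<psi> s x < 1\<close>
    keeps the product with \<open>f\<close> integrable, and \<open>0 < \<psi> s x\<close> allows
    division. Elsewhere, up to a null set, the weight is at least 1 or \<open>l\<^sub>0\<close>, and
    the unweighted estimate suffices.\<close>
  define G where "G s = {x\<in>\<Omega> s. 0 < \<psi> s x \<and> \<psi> s x < 1}" for s
  have weighted: "AE x in M. cmod (T s f x) \<le> Cw * s powr (- 2 * \<alpha>) * (c1 * (\<integral>x. \<psi> s x * cmod (f x) \<partial>M))"
    if s: "0 < s" and f: "integrable M f" "memLp M 2 f" and supp: "\<And>x. x \<notin> G s \<Longrightarrow> f x = 0" for s f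
  proof -
    note [measurable] = \<psi>\<Omega>[OF s]
    have f_meas [measurable]: "f \<in> borel_measurable M" using f by auto
    have \<psi>f: "integrable M (\<lambda>x. complex_of_real (\<psi> s x) * f x)"
    proof (rule Bochner_Integration.integrable_bound[OF f(1)])
      have "(\<lambda>x. complex_of_real (\<psi> s x) * f x) = (\<lambda>x. complex_of_real (indicator (\<Omega> s) x * \<psi> s x) * f x)"
        using supp by (auto simp: fun_eq_iff G_def indicator_def)
      also have "\<dots> \<in> borel_measurable M" by measurable
      finally show "(\<lambda>x. complex_of_real (\<psi> s x) * f x) \<in> borel_measurable M" .
      show "AE x in M. norm (complex_of_real (\<psi> s x) * f x) \<le> norm (f x)"
      proof (rule AE_I2)
        fix x
        show "norm (complex_of_real (\<psi> s x) * f x) \<le> norm (f x)"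
          using supp[of x] by (cases "x \<in> G s") (auto simp: G_def norm_mult intro!: mult_left_le_one_le)
      qed
    qed
    \<comment> \<open>(B3) is applied to the product of the weight with \<open>f\<close>, so that
      the semigroup acts on \<open>f\<close> itself.\<close>
    have eq: "(\<lambda>x. complex_of_real (inverse (\<psi> s x)) * (complex_of_real (\<psi> s x) * f x)) = f"
    proof
      fix x show "complex_of_real (inverse (\<psi> s x)) * (complex_of_real (\<psi> s x) * f x) = f x"
        using supp[of x] by (cases "x \<in> G s") (auto simp: G_def)
    qed
    have nn: "0 \<le> c1 * (\<integral>x. \<psi> s x * cmod (f x) \<partial>M)"
      using hc2 \<psi>_nonneg[OF s] by (intro mult_nonneg_nonneg integral_nonneg_AE) auto
    show ?thesis
    proof (rule Cw(2)[where w="\<psi> s"])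
      fix t assume t: "s / 2 \<le> t" "t \<le> s"
      have "Lnorm M 1 (\<lambda>x. complex_of_real (\<psi> s x) * T t f x)
          \<le> ennreal c1 * Lnorm M 1 (\<lambda>x. complex_of_real (\<psi> s x) * f x)"
        using B3[OF s t, of "\<lambda>x. complex_of_real (\<psi> s x) * f x"] f unfolding eq by (simp add: memLp_1_iff)
      also have "\<dots> = ennreal (c1 * (\<integral>x. \<psi> s x * cmod (f x) \<partial>M))"
        using hc2 \<psi>_nonneg[OF s] by (simp add: Lnorm_1[OF \<psi>f] norm_mult ennreal_mult)
      finally have le: "Lnorm M 1 (\<lambda>x. complex_of_real (\<psi> s x) * T t f x)
          \<le> ennreal (c1 * (\<integral>x. \<psi> s x * cmod (f x) \<partial>M))" .
      then have i: "integrable M (\<lambda>x. complex_of_real (\<psi> s x) * T t f x)"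
        using memLp_if_Lnorm_le memLp_1_iff by metis
      have "(\<integral>x. \<psi> s x * cmod (T t f x) \<partial>M) \<le> c1 * (\<integral>x. \<psi> s x * cmod (f x) \<partial>M)"
        using le nn \<psi>_nonneg[OF s] unfolding Lnorm_1[OF i] by (simp add: norm_mult)
      then show "integrable M (\<lambda>x. \<psi> s x * cmod (T t f x)) \<and>
          (\<integral>x. \<psi> s x * cmod (T t f x) \<partial>M) \<le> c1 * (\<integral>x. \<psi> s x * cmod (f x) \<partial>M)"
        using integrable_norm[OF i] \<psi>_nonneg[OF s] by (simp add: norm_mult)
    next
      fix l assume l: "0 < l" "l \<le> l\<^sub>0"
      show "\<exists>E\<in>sets M. (\<forall>x\<in>E. l \<le> \<psi> s x) \<and> emeasure M (space M - E) \<le> ennreal ((m * l powr \<gamma> * s powr \<alpha>)\<^sup>2)"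
      proof (intro bexI[of _ "space M - {x\<in>\<Omega> s. \<psi> s x < l}"] conjI ballI)
        fix x assume "x \<in> space M - {x\<in>\<Omega> s. \<psi> s x < l}"
        then show "l \<le> \<psi> s x"
          using \<psi>_ge[OF s, of x] l by (cases "x \<in> \<Omega> s") auto
      next
        have "space M - (space M - {x\<in>\<Omega> s. \<psi> s x < l}) = {x\<in>\<Omega> s. \<psi> s x < l}"
          by (auto simp: space)
        then show "emeasure M (space M - (space M - {x\<in>\<Omega> s. \<psi> s x < l})) \<le> ennreal ((m * l powr \<gamma> * s powr \<alpha>)\<^sup>2)"
          using sub_measure[OF s l(1)] by simp
      qed (use sub_meas(1)[OF s] in auto)
    qed (use s f nn \<psi>_nonneg in auto)
  qed
  define C0 where "C0 = max (Cw * c1) (Cu * Mc)"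
  have C0: "0 \<le> C0" "Cw * c1 \<le> C0" "Cu * Mc \<le> C0"
    using Cw(1) hc2 by (auto simp: C0_def le_max_iff_disj)
  \<comment> \<open>The 2 comes from the kernel bound; the maximum pays for replacing 1 by a
    multiple of the weight outside \<open>G t\<close>.\<close>
  define C where "C = 2 * C0 * max 1 (1 / l\<^sub>0)"
  show ?thesis
  proof (intro exI[of _ C] allI impI)
    fix t :: real assume t: "0 < t"
    define K where "K = C0 * t powr (- 2 * \<alpha>)"
    have K: "0 \<le> K" using C0 by (simp add: K_def)
    \<comment> \<open>The constant value outside \<open>G t\<close> keeps \<open>\<phi>\<close>
      measurable and at most \<open>K\<close>; it is compared with \<open>\<psi> t\<close> only
      after the kernel has been found.\<close>
    define \<phi> where "\<phi> y = K * (if y \<in> G t then \<psi> t y else 1)" for y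
    have [measurable]: "G t \<in> sets M"
      unfolding G_def by (rule sub_meas(2)[OF t])
    have \<phi>01: "0 \<le> \<phi> y" "\<phi> y \<le> K" for y
      using K by (auto simp: \<phi>_def G_def intro!: mult_left_le)
    interpret dominated_operator M "T t" \<phi> K
    proof
      have "\<phi> = (\<lambda>y. K * (if y \<in> G t then indicator (\<Omega> t) y * \<psi> t y else 1))"
        by (auto simp: \<phi>_def fun_eq_iff G_def)
      also have "\<dots> \<in> borel_measurable M"
        using \<psi>\<Omega>[OF t] by measurable
      finally show \<phi>_meas: "\<phi> \<in> borel_measurable M" .
      show "T t f \<in> borel_measurable M" if "memLp M 2 f" for f
        using contraction_C0_semigroup_memLp(1)[OF sg _ that, of t] t by (simp add: memLp_def)
      show add: "AE x in M. T t (\<lambda>y. f y + g y) x = T t f x + T t g x" if "memLp M 2 f" "memLp M 2 g" for f g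
        using sg t that by (auto simp: contraction_C0_semigroup_def)
      show "AE x in M. T t (\<lambda>y. a * f y) x = a * T t f x" if "memLp M 2 f" for f a
        using sg t that by (auto simp: contraction_C0_semigroup_def)
      fix f :: "'a \<Rightarrow> complex" assume f: "integrable M f" "memLp M 2 f"
      have f_meas [measurable]: "f \<in> borel_measurable M" using f by auto
      \<comment> \<open>The part on \<open>G t\<close> goes to the weighted estimate, the rest to
        the unweighted one.\<close>
      define f1 where "f1 y = (if y \<in> G t then f y else 0)" for y
      define f2 where "f2 y = (if y \<in> G t then 0 else f y)" for y
      have [measurable]: "f1 \<in> borel_measurable M" "f2 \<in> borel_measurable M"
        unfolding f1_def f2_def by measurable
      have f1: "integrable M f1" "memLp M 2 f1"
        using Bochner_Integration.integrable_bound[OF f(1), of f1] memLp_2_bounded[OF f(2), of f1]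
        by (auto simp: f1_def)
      have f2: "integrable M f2" "memLp M 2 f2"
        using Bochner_Integration.integrable_bound[OF f(1), of f2] memLp_2_bounded[OF f(2), of f2]
        by (auto simp: f2_def)
      have \<phi>_int: "integrable M (\<lambda>y. \<phi> y * cmod (g y))" if "integrable M g" for g :: "'a \<Rightarrow> complex"
      proof (rule Bochner_Integration.integrable_bound)
        show "integrable M (\<lambda>y. K * cmod (g y))" using that by auto
        have "g \<in> borel_measurable M" using that by auto
        with \<phi>_meas show "(\<lambda>y. \<phi> y * cmod (g y)) \<in> borel_measurable M" by measurable
        show "AE y in M. norm (\<phi> y * cmod (g y)) \<le> norm (K * cmod (g y))"
          using \<phi>01 K by (intro AE_I2) (simp add: abs_mult mult_right_mono)
      qed
      have "Cw * t powr (- 2 * \<alpha>) * (c1 * (\<integral>y. \<psi> t y * cmod (f1 y) \<partial>M))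
          = (Cw * c1 * t powr (- 2 * \<alpha>)) * (\<integral>y. \<psi> t y * cmod (f1 y) \<partial>M)"
        by (simp add: mult_ac)
      also have "\<dots> \<le> K * (\<integral>y. \<psi> t y * cmod (f1 y) \<partial>M)"
        unfolding K_def using C0 \<psi>_nonneg[OF t]
        by (intro mult_right_mono integral_nonneg_AE) auto
      also have "\<dots> = (\<integral>y. K * (\<psi> t y * cmod (f1 y)) \<partial>M)"
        by simp
      also have "\<dots> = (\<integral>y. \<phi> y * cmod (f1 y) \<partial>M)"
        by (intro Bochner_Integration.integral_cong) (auto simp: \<phi>_def f1_def)
      finally have le1: "Cw * t powr (- 2 * \<alpha>) * (c1 * (\<integral>y. \<psi> t y * cmod (f1 y) \<partial>M)) \<le> (\<integral>y. \<phi> y * cmod (f1 y) \<partial>M)" .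
      have "Cu * t powr (- 2 * \<alpha>) * (Mc * (\<integral>y. cmod (f2 y) \<partial>M))
          = (Cu * Mc * t powr (- 2 * \<alpha>)) * (\<integral>y. cmod (f2 y) \<partial>M)"
        by (simp add: mult_ac)
      also have "\<dots> \<le> K * (\<integral>y. cmod (f2 y) \<partial>M)"
        unfolding K_def using C0 by (intro mult_right_mono integral_nonneg_AE) auto
      also have "\<dots> = (\<integral>y. K * cmod (f2 y) \<partial>M)"
        by simp
      also have "\<dots> = (\<integral>y. \<phi> y * cmod (f2 y) \<partial>M)"
        by (intro Bochner_Integration.integral_cong) (auto simp: \<phi>_def f2_def)
      finally have le2: "Cu * t powr (- 2 * \<alpha>) * (Mc * (\<integral>y. cmod (f2 y) \<partial>M)) \<le> (\<integral>y. \<phi> y * cmod (f2 y) \<partial>M)" .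
      have "(\<integral>y. \<phi> y * cmod (f1 y) \<partial>M) + (\<integral>y. \<phi> y * cmod (f2 y) \<partial>M) = (\<integral>y. \<phi> y * cmod (f1 y) + \<phi> y * cmod (f2 y) \<partial>M)"
        by (intro Bochner_Integration.integral_add[symmetric] \<phi>_int f1 f2)
      also have "\<dots> = (\<integral>y. \<phi> y * cmod (f y) \<partial>M)"
        by (intro Bochner_Integration.integral_cong) (auto simp: f1_def f2_def)
      finally have split: "(\<integral>y. \<phi> y * cmod (f1 y) \<partial>M) + (\<integral>y. \<phi> y * cmod (f2 y) \<partial>M) = (\<integral>y. \<phi> y * cmod (f y) \<partial>M)" .
      have "(\<lambda>y. f1 y + f2 y) = f" by (auto simp: f1_def f2_def)
      then have "AE x in M. T t f x = T t f1 x + T t f2 x"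
        using add[OF f1(2) f2(2)] by simp
      moreover have "AE x in M. cmod (T t f1 x) \<le> Cw * t powr (- 2 * \<alpha>) * (c1 * (\<integral>x. \<psi> t x * cmod (f1 x) \<partial>M))"
        by (intro weighted t f1) (auto simp: f1_def)
      moreover have "AE x in M. cmod (T t f2 x) \<le> Cu * t powr (- 2 * \<alpha>) * (Mc * (\<integral>x. cmod (f2 x) \<partial>M))"
        by (intro unweighted t f2)
      ultimately show "AE x in M. cmod (T t f x) \<le> (\<integral>y. \<phi> y * cmod (f y) \<partial>M)"
      proof eventually_elim
        case (elim x)
        then show ?case
          using norm_triangle_ineq[of "T t f1 x" "T t f2 x"] le1 le2 split by simp
      qed
    qed (use \<phi>01 in auto)
    obtain k where k: "(\<lambda>z. k (fst z) (snd z)) \<in> borel_measurable (M \<Otimes>\<^sub>M M)"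
      "\<And>x y. cmod (k x y) \<le> 2 * \<phi> y"
      "\<And>f. integrable M f \<Longrightarrow> memLp M 2 f \<Longrightarrow>
         AE x in M. integrable M (\<lambda>y. k x y * f y) \<and> T t f x = (\<integral>y. k x y * f y \<partial>M)"
      using kernel_exists by blast
    have \<phi>_\<psi>: "2 * \<phi> y \<le> C * t powr (- (j / (j - 1))) * \<psi> t y" if "y \<in> \<Omega> t \<longrightarrow> 0 < \<psi> t y" for y
    proof -
      have "(if y \<in> G t then \<psi> t y else 1) \<le> max 1 (1 / l\<^sub>0) * \<psi> t y"
      proof (cases "y \<in> \<Omega> t")
        case True
        then have "(if y \<in> G t then \<psi> t y else 1) \<le> 1 * \<psi> t y" using that by (auto simp: G_def)
        also have "\<dots> \<le> max 1 (1 / l\<^sub>0) * \<psi> t y"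
          using \<psi>_nonneg[OF t] by (intro mult_right_mono) auto
        finally show ?thesis .
      next
        case False
        then have "(if y \<in> G t then \<psi> t y else 1) \<le> 1 / l\<^sub>0 * \<psi> t y"
          using \<psi>_ge[OF t False] l0 by (simp add: G_def)
        also have "\<dots> \<le> max 1 (1 / l\<^sub>0) * \<psi> t y"
          using \<psi>_nonneg[OF t] by (intro mult_right_mono) auto
        finally show ?thesis .
      qed
      then have "2 * (K * (if y \<in> G t then \<psi> t y else 1)) \<le> 2 * (K * (max 1 (1 / l\<^sub>0) * \<psi> t y))"
        using K by (intro mult_left_mono) auto
      then show ?thesis
        unfolding \<phi>_def C_def K_def \<alpha>2 by (simp only: mult_ac)
    qed
    \<comment> \<open>\<open>Z\<close> contains the zeros of the weight in
      \<open>\<Omega> t\<close>. As \<open>\<psi> t\<close> may fail to be measurable, the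
      exceptional set in the product is merely covered by the null set
      \<open>space M \<times> Z\<close>.\<close>
    obtain Z where Z: "Z \<in> null_sets M" "\<And>y. y \<notin> Z \<Longrightarrow> y \<in> \<Omega> t \<longrightarrow> 0 < \<psi> t y"
      using conjunct1[OF B23[OF t]] by (auto elim!: AE_E simp: space null_sets_def) blast
    have "space M \<times> Z \<in> null_sets (M \<Otimes>\<^sub>M M)"
      using Z(1) by (intro times_in_null_sets2) auto
    then have "AE z in M \<Otimes>\<^sub>M M. cmod (k (fst z) (snd z)) \<le> C * t powr (- (j / (j - 1))) * \<psi> t (snd z)"
    proof (rule AE_I')
      show "{z \<in> space (M \<Otimes>\<^sub>M M). \<not> cmod (k (fst z) (snd z)) \<le> C * t powr (- (j / (j - 1))) * \<psi> t (snd z)} \<subseteq> space M \<times> Z"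
      proof
        fix z assume z: "z \<in> {z \<in> space (M \<Otimes>\<^sub>M M). \<not> cmod (k (fst z) (snd z)) \<le> C * t powr (- (j / (j - 1))) * \<psi> t (snd z)}"
        have "snd z \<in> Z"
          using z order_trans[OF k(2) \<phi>_\<psi>[OF Z(2)], of "snd z" "fst z"] by auto
        then show "z \<in> space M \<times> Z"
          by (cases z) (auto simp: space)
      qed
    qed
    with k(1,3) show "\<exists>k :: 'a \<Rightarrow> 'a \<Rightarrow> complex.
           (\<lambda>z. k (fst z) (snd z)) \<in> borel_measurable (M \<Otimes>\<^sub>M M) \<and>
           (\<forall>f. memLp M 1 f \<and> memLp M 2 f \<longrightarrow>
              (AE x in M. integrable M (\<lambda>y. k x y * f y) \<and>
                          T t f x = (\<integral>y. k x y * f y \<partial>M))) \<and>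
           (AE z in M \<Otimes>\<^sub>M M. cmod (k (fst z) (snd z)) \<le> C * t powr (- (j / (j - 1))) * \<psi> t (snd z))"
      by (intro exI[of _ k]) (auto simp: memLp_1_iff)
  qed
qed

end
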